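(* Let $G$ be a finitely generated group, let $\varphi\colon G\twoheadrightarrow\mathbb{Z}$ be algebraically fibred (i.e. an epimorphism with finitely generated kernel), and let $\rho\colon G\twoheadrightarrow Q\to\mathrm{GL}_k(\mathbb{Q})$ be a representation factoring through a finite group $Q$. Then $$\Delta_0^{\varphi,\rho}(t)\doteq(1-t)^mP(t),$$ where $m\ge0$ and $P(t)$ is a product of cyclotomic polynomials, up to multiplication by monomials with coefficients in $\mathbb{Q}^\times$. In particular, $\Delta_0^{\varphi,\rho}(t)\doteq\Delta_0^{\varphi,\rho}(t^{-1})$.
   Context: Give $\mathbb{Q}^k[t^{\pm1}]$ the $\mathbb{Q}G$-module structure in which $g\in G$ acts as $t^{\varphi(g)}\rho(g)$. The zeroth twisted Alexander polynomial $\Delta_0^{\varphi,\rho}(t)\in\mathbb{Q}[t^{\pm1}]$ is the order of the $\mathbb{Q}[t^{\pm1}]$-module $H_0(G;\mathbb{Q}^k[t^{\pm1}])$, i.e. the greatest common divisor of all maximal minors in a presentation matrix of this module; it is well defined up to units of $\mathbb{Q}[t^{\pm1}]$. $p(t)\doteq q(t)$ means $p=uq$ for a unit $u$ of $\mathbb{Q}[t^{\pm1}]$ (a monomial with coefficient in $\mathbb{Q}^\times$). *)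

theory Defs
  imports
    Complex_Main
    "HOL-Library.Poly_Mapping"
    "HOL-Algebra.AbelCoset"
    "HOL-Algebra.Elementary_Groups"
    "Jordan_Normal_Form.Determinant"
    "Jordan_Normal_Form.DL_Submatrix"
begin

section \<open>Laurent polynomials\<close>

text \<open>The ring of rational Laurent polynomials is the group ring of the integers: a finitely
  supported map from exponents to coefficients, multiplied by convolution.\<close>

type_synonym laurent = "int \<Rightarrow>\<^sub>0 rat"

abbreviation lconst :: "rat \<Rightarrow> laurent" where
  "lconst c \<equiv> Poly_Mapping.single 0 c"

abbreviation tpow :: "int \<Rightarrow> laurent" where
  "tpow n \<equiv> Poly_Mapping.single n 1"

definition laurent_of_poly :: "rat poly \<Rightarrow> laurent" where
  "laurent_of_poly p = (\<Sum>i\<le>degree p. Poly_Mapping.single (int i) (coeff p i))"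

text \<open>The substitution of the inverse of \<open>t\<close> for \<open>t\<close>: the coefficient at \<open>n\<close> of the result is
  the coefficient at \<open>- n\<close> of the argument.\<close>

definition subst_inverse :: "laurent \<Rightarrow> laurent" where
  "subst_inverse p = Poly_Mapping.map_key uminus p"

definition eq_up_to_unit :: "'r::comm_ring_1 \<Rightarrow> 'r \<Rightarrow> bool"  (infix \<open>\<doteq>\<close> 50) where
  "p \<doteq> q \<longleftrightarrow> (\<exists>u. u dvd 1 \<and> p = u * q)"

section \<open>Cyclotomic polynomials\<close>

definition primitive_roots_of_unity :: "nat \<Rightarrow> complex set" where
  "primitive_roots_of_unity n = {z. z ^ n = 1 \<and> (\<forall>m. 0 < m \<and> m < n \<longrightarrow> z ^ m \<noteq> 1)}"

definition is_cyclotomic :: "rat poly \<Rightarrow> bool" where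
  "is_cyclotomic p \<longleftrightarrow>
     (\<exists>n>0. map_poly of_rat p = (\<Prod>z\<in>primitive_roots_of_unity n. [:- z, 1:]))"

definition is_product_of_cyclotomics :: "laurent \<Rightarrow> bool" where
  "is_product_of_cyclotomics P \<longleftrightarrow>
     (\<exists>ps. (\<forall>p\<in>set ps. is_cyclotomic p) \<and> P = laurent_of_poly (prod_list ps))"

section \<open>Order of a module\<close>

text \<open>Modules are the records of \<^theory>\<open>HOL-Algebra.Module\<close>, with scalars all elements of
  the type \<open>'r\<close>; the fields \<open>mult\<close> and \<open>one\<close> are not used.

  The matrix \<open>A\<close>, with \<open>m\<close> rows and \<open>n\<close> columns, presents \<open>M\<close> if there is an exact sequence
  \<open>R^n \<rightarrow> R^m \<rightarrow> M \<rightarrow> 0\<close> whose first map is \<open>A\<close>: rows are generators and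
  columns are relations.\<close>

definition is_presentation_matrix :: "('r::comm_ring_1, 'm) module \<Rightarrow> 'r mat \<Rightarrow> bool" where
  "is_presentation_matrix M A \<longleftrightarrow>
     (\<exists>f \<in> epi (add_monoid (module_vec TYPE('r) (dim_row A))) (add_monoid M).
        (\<forall>r. \<forall>v\<in>carrier_vec (dim_row A). f (r \<cdot>\<^sub>v v) = r \<odot>\<^bsub>M\<^esub> f v) \<and>
        a_kernel (module_vec TYPE('r) (dim_row A)) M f
          = (\<lambda>x. A *\<^sub>v x) ` carrier_vec (dim_col A))"

text \<open>The maximal minors have the size of the number of generators. If there are fewer
  relations than generators there are none, and the greatest common divisor is \<open>0\<close>.\<close>

definition maximal_minors :: "'r::comm_ring_1 mat \<Rightarrow> 'r set" where
  "maximal_minors A =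
     {det (submatrix A UNIV J) | J. J \<subseteq> {..<dim_col A} \<and> card J = dim_row A}"

definition is_gcd_of :: "'r::comm_ring_1 set \<Rightarrow> 'r \<Rightarrow> bool" where
  "is_gcd_of S d \<longleftrightarrow> (\<forall>a\<in>S. d dvd a) \<and> (\<forall>c. (\<forall>a\<in>S. c dvd a) \<longrightarrow> c dvd d)"

definition is_order_of :: "('r::comm_ring_1, 'm) module \<Rightarrow> 'r \<Rightarrow> bool" where
  "is_order_of M d \<longleftrightarrow>
     (\<exists>A. is_presentation_matrix M A \<and> is_gcd_of (maximal_minors A) d)"

section \<open>Zeroth homology of a group\<close>

definition quot_module :: "('r, 'm) module \<Rightarrow> 'm set \<Rightarrow> ('r, 'm set) module" where
  "quot_module M N =
     \<lparr>carrier = a_rcosets\<^bsub>M\<^esub> N, monoid.mult = undefined, one = undefined,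
      zero = N, add = (\<lambda>X Y. X <+>\<^bsub>M\<^esub> Y),
      module.smult = (\<lambda>r X. \<Union>x\<in>X. N +>\<^bsub>M\<^esub> (r \<odot>\<^bsub>M\<^esub> x))\<rparr>"

text \<open>The zeroth homology of \<open>G\<close> with coefficients in \<open>M\<close>, on which \<open>G\<close> acts by \<open>act\<close>, is the
  module of coinvariants: the cokernel of the last differential of the bar complex, which sends
  \<open>[g] \<otimes> v\<close> to \<open>g v - v\<close>.\<close>

definition group_homology0 ::
    "('g, 'a) monoid_scheme \<Rightarrow> ('r, 'm) module \<Rightarrow> ('g \<Rightarrow> 'm \<Rightarrow> 'm) \<Rightarrow> ('r, 'm set) module" where
  "group_homology0 G M act =
     quot_module M
       (generate (add_monoid M) {act g v \<ominus>\<^bsub>M\<^esub> v | g v. g \<in> carrier G \<and> v \<in> carrier M})"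

section \<open>The zeroth twisted Alexander polynomial\<close>

definition general_linear_group :: "nat \<Rightarrow> rat mat monoid" where
  "general_linear_group k = units_of (ring_mat TYPE(rat) k ())"

definition twisted_action ::
    "('g \<Rightarrow> int) \<Rightarrow> ('g \<Rightarrow> rat mat) \<Rightarrow> 'g \<Rightarrow> laurent vec \<Rightarrow> laurent vec" where
  "twisted_action \<phi> \<rho> g v = tpow (\<phi> g) \<cdot>\<^sub>v (map_mat lconst (\<rho> g) *\<^sub>v v)"

text \<open>The polynomial is only determined up to units, so being one is a predicate.\<close>

definition is_twisted_alexander0 ::
    "('g, 'a) monoid_scheme \<Rightarrow> nat \<Rightarrow> ('g \<Rightarrow> int) \<Rightarrow> ('g \<Rightarrow> rat mat) \<Rightarrow> laurent \<Rightarrow> bool" where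
  "is_twisted_alexander0 G k \<phi> \<rho> \<Delta> \<longleftrightarrow>
     is_order_of (group_homology0 G (module_vec TYPE(laurent) k) (twisted_action \<phi> \<rho>)) \<Delta>"

section \<open>Algebraic fibrations\<close>

definition finitely_generated_group :: "('g, 'a) monoid_scheme \<Rightarrow> bool" where
  "finitely_generated_group G \<longleftrightarrow>
     group G \<and> (\<exists>S. finite S \<and> S \<subseteq> carrier G \<and> generate G S = carrier G)"

definition algebraically_fibred :: "('g, 'a) monoid_scheme \<Rightarrow> ('g \<Rightarrow> int) \<Rightarrow> bool" where
  "algebraically_fibred G \<phi> \<longleftrightarrow>
     \<phi> \<in> epi G integer_group \<and>
     finitely_generated_group (G\<lparr>carrier := kernel G integer_group \<phi>\<rparr>)"

end

theory Submission
  imports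
    "HOL-Algebra.Multiplicative_Group"
    Defs
    "Jordan_Normal_Form.Char_Poly"
begin

text \<open>
  Choose \<open>g\<close> with \<open>\<phi> g = 1\<close> and let \<open>q\<close> be the order of \<open>Q\<close>. Then \<open>g ^ q\<close> acts as \<open>t ^ q\<close>, so
  \<open>t ^ q - 1\<close> annihilates the module of coinvariants. If \<open>A\<close> is any presentation matrix with \<open>r\<close>
  rows, this gives \<open>A X = (t ^ q - 1) I\<close> for some \<open>X\<close>; expanding \<open>det (A X)\<close> along the columns of
  \<open>A\<close> shows that every common divisor of the maximal minors of \<open>A\<close> divides \<open>(t ^ q - 1) ^ r\<close>.
  Up to a monomial, a divisor of \<open>(t ^ q - 1) ^ r\<close> is a rational polynomial all of whose complex
  roots are roots of unity, hence a product of cyclotomic polynomials because these are irreducible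
  over the rationals. The factor \<open>1 - t\<close> is cyclotomic up to sign, so the exponent \<open>m\<close> of the statement
  can be taken to be \<open>0\<close>, and the symmetry holds because cyclotomic polynomials are reciprocal up
  to a constant.
\<close>

section \<open>Irreducibility of cyclotomic polynomials\<close>

text \<open>\<open>f\<close> generates the kernel of the evaluation \<open>Z[X] -> C\<close> at
  \<open>z\<close>. Divisibility is required over the integers, so that leading coefficients can be
  compared in factorizations of \<open>X ^ n - 1\<close> in \<open>Z[X]\<close>.\<close>

definition int_minimal :: "int poly \<Rightarrow> complex \<Rightarrow> bool" where
  "int_minimal f z \<longleftrightarrow> f \<noteq> 0 \<and> poly (map_poly of_int f) z = 0 \<and>
     (\<forall>h. poly (map_poly of_int h) z = 0 \<longrightarrow> f dvd h)"

text \<open>A polynomial of least degree need only divide up to a constant over the integers; dividing by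
  its content repairs this (Gauss's lemma).\<close>

lemma int_minimal_exists:
  assumes "h0 \<noteq> 0" "poly (map_poly of_int h0) z = 0"
  shows "\<exists>f. int_minimal f z"
proof -
  define R where "R = (\<lambda>h::int poly. h \<noteq> 0 \<and> poly (map_poly of_int h) z = 0)"
  have "R h0" using assms by (simp add: R_def)
  then obtain f0 where f0: "R f0" and min: "\<And>h. R h \<Longrightarrow> degree f0 \<le> degree h"
    using ex_has_least_nat[of R h0 degree] by blast
  define f where "f = primitive_part f0"
  have f0_eq: "f0 = smult (content f0) f" by (simp add: f_def)
  have nz: "f0 \<noteq> 0" using f0 by (simp add: R_def)
  have cf: "content f = 1" using nz by (simp add: f_def)
  have fnz: "f \<noteq> 0" using nz by (simp add: f_def)
  have deg: "degree f = degree f0" by (simp add: f_def)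
  have "poly (map_poly of_int f0) z = of_int (content f0) * poly (map_poly of_int f) z"
    by (subst f0_eq) (simp add: of_int_hom.map_poly_hom_smult)
  then have rt: "poly (map_poly of_int f) z = 0"
    using f0 nz by (simp add: R_def)
  have "f dvd h" if h: "poly (map_poly of_int h) z = 0" for h
  proof -
    obtain q r where qr: "pseudo_divmod h f = (q, r)" by fastforce
    define c where "c = lead_coeff f ^ (Suc (degree h) - degree f)"
    have c0: "c \<noteq> 0" using fnz by (simp add: c_def)
    have eq: "smult c h = f * q + r" and dr: "r = 0 \<or> degree r < degree f"
      using pseudo_divmod[OF fnz qr] by (simp_all add: c_def)
    have "poly (map_poly of_int (smult c h)) z = poly (map_poly of_int (f * q + r)) z"
      by (simp only: eq)
    then have "poly (map_poly of_int r) z = 0"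
      by (simp add: of_int_hom.map_poly_hom_smult of_int_poly_hom.hom_add of_int_poly_hom.hom_mult h rt)
    then have r0: "r = 0"
      using min[of r] dr deg by (force simp: R_def)
    \<comment> \<open>Since \<open>content f = 1\<close>, the content of \<open>f * q\<close> is
      that of \<open>q\<close>; so the pseudo-division factor \<open>c\<close> divides
      \<open>q\<close> and can be cancelled.\<close>
    have "normalize c * content h = content q"
      using arg_cong[OF eq, of content] r0 by (simp add: content_mult cf)
    then have "c dvd content q" by (metis dvd_triv_left normalize_dvd_iff)
    then obtain q' where "q = smult c q'"
      by (metis const_poly_dvd_iff_dvd_content dvdE mult_pCons_left add.right_neutral mult_zero_left
          pCons_0_0)
    then have "smult c h = smult c (f * q')" using eq r0 by simp
    then have "smult c (h - f * q') = 0" by (simp add: smult_diff_right)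
    then have "h = f * q'" using c0 by simp
    then show ?thesis by simp
  qed
  then show ?thesis using fnz rt unfolding int_minimal_def by blast
qed

lemma int_minimal_degree_le:
  assumes "int_minimal f z" "poly (map_poly of_int h) z = 0" "h \<noteq> 0"
  shows "degree f \<le> degree h"
  using assms by (auto simp: int_minimal_def intro: dvd_imp_degree_le)

lemma int_minimal_degree_pos:
  assumes "int_minimal f z"
  shows "degree f > 0"
proof (rule ccontr)
  assume "\<not> degree f > 0"
  then obtain a where "f = [:a:]" by (auto elim: degree_eq_zeroE)
  with assms show False by (auto simp: int_minimal_def)
qed

text \<open>If \<open>h\<close> did not vanish at \<open>z\<close>, its cofactor \<open>u\<close> in
  \<open>f\<close> would, although \<open>u\<close> has smaller degree than the minimal polynomial
  \<open>f\<close>. This is used to show that the conjugates of a root of unity have the same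
  order.\<close>

lemma int_minimal_unique:
  assumes f: "int_minimal f z" and h: "int_minimal h w" and fw: "poly (map_poly of_int f) w = 0"
  shows "poly (map_poly of_int h) z = 0"
proof -
  obtain u where u: "f = h * u" using h fw by (auto simp: int_minimal_def dvd_def)
  have fz: "poly (map_poly of_int f) z = 0" "f \<noteq> 0" using f by (auto simp: int_minimal_def)
  show ?thesis
  proof (rule ccontr)
    assume "poly (map_poly of_int h) z \<noteq> 0"
    then have "poly (map_poly of_int u) z = 0" using fz u by (simp add: of_int_poly_hom.hom_mult)
    then have "degree f \<le> degree u"
      using int_minimal_degree_le[OF f] fz u by auto
    moreover have "degree f = degree h + degree u" using fz u by (auto simp: degree_mult_eq)
    ultimately show False using int_minimal_degree_pos[OF h] by simp
  qed
qed

section \<open>Congruences modulo a prime and prime powers of roots of unity\<close>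

lemma prime_dvd_power_add:
  fixes u v :: "'a::comm_ring_1"
  assumes p: "prime p"
  shows "of_nat p dvd (u + v) ^ p - (u ^ p + v ^ p)"
proof -
  have p0: "p > 0" using p prime_gt_0_nat by blast
  have "(u + v) ^ p = (\<Sum>k\<le>p. of_nat (p choose k) * u ^ k * v ^ (p - k))"
    by (rule binomial_ring)
  \<comment> \<open>Splitting off the two end terms leaves the coefficients
    \<open>p choose k\<close> with \<open>0 < k < p\<close>, all divisible by
    \<open>p\<close>.\<close>
  also have "{..p} = insert 0 (insert p {1..<p})" using p0 by auto
  also have "(\<Sum>k\<in>insert 0 (insert p {1..<p}). of_nat (p choose k) * u ^ k * v ^ (p - k))
      = v ^ p + (u ^ p + (\<Sum>k\<in>{1..<p}. of_nat (p choose k) * u ^ k * v ^ (p - k)))"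
    using p0 by simp
  finally have "(u + v) ^ p - (u ^ p + v ^ p)
      = (\<Sum>k\<in>{1..<p}. of_nat (p choose k) * u ^ k * v ^ (p - k))" by simp
  moreover have "of_nat p dvd (\<Sum>k\<in>{1..<p}. of_nat (p choose k) * u ^ k * v ^ (p - k))"
  proof (rule dvd_sum)
    fix k assume k: "k \<in> {1..<p}"
    then have "p dvd (p choose k)" using p by (intro dvd_choose_prime) auto
    then have "(of_nat p :: 'a) dvd of_nat (p choose k)" by (metis dvd_def of_nat_mult)
    then show "of_nat p dvd of_nat (p choose k) * u ^ k * v ^ (p - k)"
      by (simp add: mult.assoc)
  qed
  ultimately show ?thesis by simp
qed

text \<open>Fermat's little theorem, by induction away from 0 in both directions: modulo
  \<open>p\<close> the \<open>p\<close>-th power is additive, so each step only adds or removes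
  \<open>1 ^ p = 1\<close>.\<close>

lemma prime_dvd_power_diff_self:
  fixes a :: int
  assumes p: "prime p"
  shows "int p dvd a ^ p - a"
proof (induction a rule: int_induct[where k = 0])
  case base
  show ?case using p prime_gt_0_nat[of p] by (simp add: power_0_left)
next
  case (step1 i)
  have "(i + 1) ^ p - (i + 1) = ((i + 1) ^ p - (i ^ p + 1 ^ p)) + (i ^ p - i)" by simp
  then show ?case using prime_dvd_power_add[OF p, of i 1] step1(2) by (metis dvd_add of_nat_id)
next
  case (step2 i)
  have "(i - 1) ^ p - (i - 1) = (i ^ p - i) - ((i - 1 + 1) ^ p - ((i - 1) ^ p + 1 ^ p))" by simp
  then show ?case using prime_dvd_power_add[OF p, of "i - 1" 1] step2(2) by (metis dvd_diff of_nat_id)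
qed

text \<open>Modulo \<open>p\<close> the \<open>p\<close>-th power is additive and, by Fermat, fixes
  integer coefficients, so its whole effect is to replace \<open>X\<close> by \<open>X ^ p\<close>.
  The induction peels off the constant coefficient.\<close>

lemma prime_dvd_pcompose_power:
  fixes g :: "int poly"
  assumes p: "prime p"
  shows "of_nat p dvd pcompose g (monom 1 p) - g ^ p"
proof (induction g)
  case 0
  then show ?case using p prime_gt_0_nat[of p] by (simp add: power_0_left)
next
  case (pCons a q)
  have Xq: "([:0, 1:] * q) ^ p = monom 1 p * q ^ p"
    using power_mult_distrib[of "[:0, 1:]" q p] by (simp add: monom_altdef)
  have const: "[:a ^ p - a:] = [:a:] ^ p - [:a:]" by (simp add: poly_const_pow)
  have split: "pCons a q = [:a:] + [:0, 1:] * q" by simp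
  have comp: "pcompose (pCons a q) (monom 1 p) = [:a:] + monom 1 p * pcompose q (monom 1 p)"
    by (simp add: pcompose_pCons)
  \<comment> \<open>Here \<open>u\<close> is the constant part, \<open>m\<close> is
    \<open>X ^ p\<close>, \<open>c\<close> is \<open>q(X ^ p)\<close>, and \<open>s\<close>,
    \<open>up\<close>, \<open>qp\<close> are the \<open>p\<close>-th powers of the whole polynomial,
    of \<open>u\<close> and of \<open>q\<close>. The three resulting terms are divisible by
    \<open>p\<close> by the induction hypothesis, by Fermat and by the binomial theorem.\<close>
  have "u + m * c - s = m * (c - qp) - (up - u) - (s - (up + m * qp))" for u m c s up qp :: "int poly"
    by (simp add: algebra_simps)
  then have "pcompose (pCons a q) (monom 1 p) - pCons a q ^ p
     = monom 1 p * (pcompose q (monom 1 p) - q ^ p) - [:a ^ p - a:]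
       - (([:a:] + [:0, 1:] * q) ^ p - ([:a:] ^ p + ([:0, 1:] * q) ^ p))"
    unfolding Xq const comp split[symmetric] by blast
  moreover have "of_nat p dvd monom 1 p * (pcompose q (monom 1 p) - q ^ p)"
    using pCons.IH by simp
  moreover have "of_nat p dvd [:a ^ p - a:]"
  proof -
    obtain c where "a ^ p - a = int p * c" using prime_dvd_power_diff_self[OF p, of a] by (auto simp: dvd_def)
    then have "[:a ^ p - a:] = of_nat p * [:c:]" by (simp add: of_nat_poly)
    then show ?thesis by (metis dvd_triv_left)
  qed
  ultimately show ?case using prime_dvd_power_add[OF p, of "[:a:]" "[:0,1:] * q"] by (metis dvd_diff)
qed


text \<open>
  The classical proof reduces \<open>X ^ n - 1 = f g\<close> modulo \<open>p\<close> and uses that \<open>X ^ n - 1\<close> is separable there.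
  Here everything stays in \<open>\<int>[z]\<close>: if \<open>g (z ^ p) = 0\<close>, then \<open>g(z) ^ p\<close> is divisible by \<open>p\<close> because
  \<open>g(X ^ p) = g(X) ^ p\<close> modulo \<open>p\<close>, and differentiating gives \<open>n z ^ (n - 1) = f'(z) g(z)\<close>. Hence
  \<open>p\<close> divides \<open>n ^ p\<close> in \<open>\<int>[z]\<close>, and then in \<open>\<int>\<close> since \<open>\<int>[z]\<close> is free over \<open>\<int>\<close> with \<open>1\<close> in a basis.
\<close>

lemma root_power_prime:
  fixes z :: complex
  assumes p: "prime p" and pn: "\<not> p dvd n" and n: "n > 0" and zn: "z ^ n = 1"
    and h: "poly (map_poly of_int h) z = 0"
  shows "poly (map_poly of_int h) (z ^ p) = 0"
proof -
  define E where "E = (\<lambda>q::int poly. poly (map_poly of_int q) z)"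
  have E_hom: "E (a + b) = E a + E b" "E (a - b) = E a - E b" "E (a * b) = E a * E b"
      "E (a ^ k) = E a ^ k" "E [:c:] = of_int c" "E (monom 1 k) = z ^ k" "E (smult c a) = of_int c * E a"
      for a b k c
    by (simp_all add: E_def hom_distribs poly_monom)
  have E_neg: "E (- a) = - E a" for a by (simp add: E_def hom_distribs)
  define x where "x = (monom 1 n - 1 :: int poly)"
  have Ex: "E x = 0" by (simp add: x_def E_hom zn one_pCons)
  have x0: "x \<noteq> 0" using n by (auto simp: x_def monom_eq_1_iff)
  obtain f where f: "int_minimal f z" using int_minimal_exists[OF x0] Ex by (auto simp: E_def)
  have fE: "E f = 0" and fdvd: "\<And>q. E q = 0 \<Longrightarrow> f dvd q" and f0: "f \<noteq> 0"
    using f by (auto simp: int_minimal_def E_def)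
  obtain g where g: "x = f * g" using fdvd[OF Ex] by (auto simp: dvd_def)
  \<comment> \<open>As a factor of a monic polynomial, \<open>f\<close> has a unit as leading
    coefficient. Pseudo-division by \<open>f\<close> is therefore division up to the unit
    \<open>c\<close> below.\<close>
  have "lead_coeff x = 1"
    using n lead_coeff_add_le[of "- 1" "monom (1::int) n"] by (simp add: x_def degree_monom_eq)
  then have lf: "lead_coeff f * lead_coeff g = 1" by (simp add: g lead_coeff_mult)
  have "poly (map_poly of_int f) (z ^ p) = 0"
  proof (rule ccontr)
    assume fz: "poly (map_poly of_int f) (z ^ p) \<noteq> 0"
    have "poly (map_poly of_int x) (z ^ p) = 0"
      by (simp add: x_def hom_distribs poly_monom zn flip: power_mult)
        (simp add: mult.commute[of p n] power_mult zn)
    then have "poly (map_poly of_int g) (z ^ p) = 0"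
      using fz by (simp add: g hom_distribs)
    then have gz: "E (pcompose g (monom 1 p)) = 0"
      by (simp add: E_def of_int_hom.map_poly_pcompose poly_pcompose poly_monom)
    obtain r where r: "pcompose g (monom 1 p) - g ^ p = of_nat p * r"
      using prime_dvd_pcompose_power[OF p, of g] by (auto simp: dvd_def)
    have gp: "E g ^ p = - (of_nat p * E r)"
      using arg_cong[OF r, of E] gz by (simp add: E_hom of_nat_poly) (metis minus_minus)
    have "pderiv x = smult (of_nat n) (monom 1 (n - 1))"
      by (simp add: x_def pderiv_diff pderiv_monom smult_monom)
    moreover have "pderiv x = f * pderiv g + g * pderiv f"
      by (simp add: g pderiv_mult)
    ultimately have d: "of_nat n * z ^ (n - 1) = E g * E (pderiv f)"
      by (metis (no_types, lifting) E_hom(1,3,6,7) add_0 fE mult_zero_left of_int_of_nat_eq)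
    \<comment> \<open>One more factor \<open>z\<close> turns \<open>z ^ (n - 1)\<close> into
      \<open>z ^ n = 1\<close>, so \<open>n\<close> itself is a multiple of \<open>E g\<close>,
      whose \<open>p\<close>-th power is a multiple of \<open>p\<close>.\<close>
    have "of_nat n = of_nat n * z ^ (n - 1) * z"
      using n zn by (cases n) (simp_all add: mult.assoc mult.commute)
    then have "of_nat n ^ p = (E g * E (pderiv f)) ^ p * z ^ p"
      by (metis d power_mult_distrib)
    then have np: "of_nat n ^ p = of_nat p * E (- (r * pderiv f ^ p * monom 1 p))"
      by (simp add: power_mult_distrib gp E_hom E_neg)
    define s where "s = - (r * pderiv f ^ p * monom 1 p)"
    obtain q t where qt: "pseudo_divmod s f = (q, t)" by fastforce
    define c where "c = lead_coeff f ^ (Suc (degree s) - degree f)"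
    have eq: "smult c s = f * q + t" and dt: "t = 0 \<or> degree t < degree f"
      using pseudo_divmod[OF f0 qt] by (simp_all add: c_def)
    have cunit: "c dvd 1" using lf unfolding c_def
      by (metis dvd_triv_left is_unit_power_iff)
    have ct: "of_int c * E s = E t" using arg_cong[OF eq, of E] by (simp add: E_hom fE)
    \<comment> \<open>\<open>w\<close> vanishes at \<open>z\<close> and has smaller degree than
      \<open>f\<close>, so it is zero. Its constant coefficient then turns the divisibility in
      \<open>Z[z]\<close> into one between integers.\<close>
    define w where "w = [:c * int n ^ p:] - smult (int p) t"
    have "E w = of_int c * of_nat n ^ p - of_nat p * E t" by (simp add: w_def E_hom)
    also have "\<dots> = 0" by (simp add: np flip: ct s_def)
    finally have Ew: "E w = 0" .
    have dw: "degree w < degree f"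
      using dt int_minimal_degree_pos[OF f] unfolding w_def
      by (intro degree_diff_less) auto
    have "w = 0" using int_minimal_degree_le[OF f, of w] Ew dw by (fastforce simp: E_def)
    then have "coeff w 0 = 0" by simp
    then have "c * int n ^ p = int p * coeff t 0" by (simp add: w_def)
    then have "int p dvd c * int n ^ p" by simp
    then have "int p dvd int n ^ p" using cunit
      by (metis dvd_mult_unit_iff')
    then have "p dvd n ^ p" by (metis int_dvd_int_iff of_nat_power)
    then show False using p pn prime_dvd_power by blast
  qed
  moreover obtain u where "h = f * u" using fdvd[of h] h by (auto simp: E_def dvd_def)
  ultimately show ?thesis by (simp add: hom_distribs)
qed

interpretation of_rat_poly_hom: map_poly_inj_idom_hom "of_rat :: rat \<Rightarrow> complex" ..

text \<open>One prime factor of \<open>k\<close> is removed at a time. It does not divide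
  \<open>n\<close>, and the power of \<open>z\<close> with the remaining exponent is again an
  \<open>n\<close>-th root of unity at which \<open>h\<close> vanishes, so
  \<open>root_power_prime\<close> applies to it.\<close>

lemma root_power_coprime:
  fixes z :: complex
  assumes "coprime k n" "n > 0" "z ^ n = 1" "poly (map_poly of_int h) z = 0"
  shows "poly (map_poly of_int h) (z ^ k) = 0"
  using assms(1)
proof (induction k rule: less_induct)
  case (less k)
  consider "k = 0" | "k = 1" | "k > 1" by linarith
  then show ?case
  proof cases
    \<comment> \<open>Coprimality of 0 and \<open>n\<close> forces \<open>n = 1\<close>, hence
      \<open>z = 1\<close>.\<close>
    case 1
    then have "z = 1" using less.prems assms by simp
    then show ?thesis using assms by simp
  next
    case 2
    then show ?thesis using assms by simp
  next
    case 3
    then obtain p m where p: "prime p" and k: "k = p * m"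
      using prime_factor_nat[of k] by (auto simp: dvd_def)
    have "m < k" using 3 k prime_gt_1_nat[OF p] by (cases "m = 0") auto
    moreover have "coprime m n" "coprime p n" using less.prems k by auto
    ultimately have "poly (map_poly of_int h) (z ^ m) = 0" using less.IH by blast
    moreover have "\<not> p dvd n" using \<open>coprime p n\<close> p
      by (metis coprime_common_divisor dvd_refl not_prime_unit)
    moreover have "(z ^ m) ^ n = 1" using assms by (metis power_commutes power_mult power_one mult.commute)
    ultimately have "poly (map_poly of_int h) ((z ^ m) ^ p) = 0"
      using p assms(2) root_power_prime by blast
    then show ?thesis by (simp add: k mult.commute flip: power_mult)
  qed
qed

section \<open>Cyclotomic polynomials as minimal polynomials, and factorization into them\<close>

lemma finite_primitive_roots_of_unity:
  assumes "n > 0"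
  shows "finite (primitive_roots_of_unity n)"
  using finite_roots_unity[of n] assms
  by (auto simp: primitive_roots_of_unity_def intro: finite_subset[of _ "{z. z ^ n = 1}"])

lemma primitive_root_of_unity_exists:
  assumes "z ^ j = 1" "j > 0"
  shows "\<exists>n>0. z \<in> primitive_roots_of_unity n"
proof -
  define n where "n = (LEAST n. n > 0 \<and> z ^ n = 1)"
  have "n > 0 \<and> z ^ n = 1" unfolding n_def by (rule LeastI[of _ j]) (use assms in auto)
  moreover have "z ^ m \<noteq> 1" if "0 < m" "m < n" for m
    using not_less_Least[of m "\<lambda>n. n > 0 \<and> z ^ n = 1"] that by (auto simp: n_def)
  ultimately show ?thesis by (auto simp: primitive_roots_of_unity_def)
qed

text \<open>The \<open>n\<close> distinct powers of \<open>z\<close> exhaust the \<open>n\<close>-th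
  roots of unity by counting, so \<open>w = z ^ k\<close>. With \<open>d = gcd k n\<close> one has
  \<open>w ^ (n div d) = 1\<close>, and the minimality of \<open>n\<close> for \<open>w\<close>
  leaves only \<open>d = 1\<close>.\<close>

lemma primitive_roots_of_unity_power_coprime:
  assumes z: "z \<in> primitive_roots_of_unity n" and w: "w \<in> primitive_roots_of_unity n" and n: "n > 0"
  shows "\<exists>k. coprime k n \<and> w = z ^ k"
proof -
  have zn: "z ^ n = 1" and z_min: "\<And>m. 0 < m \<Longrightarrow> m < n \<Longrightarrow> z ^ m \<noteq> 1"
    and wn: "w ^ n = 1" and w_min: "\<And>m. 0 < m \<Longrightarrow> m < n \<Longrightarrow> w ^ m \<noteq> 1"
    using z w by (auto simp: primitive_roots_of_unity_def)
  have z0: "z \<noteq> 0" using zn n by (auto simp: power_0_left)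
  have "inj_on (\<lambda>k. z ^ k) {..<n}"
  proof (rule linorder_inj_onI)
    fix i j assume ij: "i < j" "i \<in> {..<n}" "j \<in> {..<n}"
    have "z ^ j = z ^ i * z ^ (j - i)" using ij by (simp flip: power_add)
    then show "z ^ i \<noteq> z ^ j" using z_min[of "j - i"] ij z0 by auto
  qed auto
  then have "card ((\<lambda>k. z ^ k) ` {..<n}) = card {z::complex. z ^ n = 1}"
    using n by (simp add: card_image card_roots_unity_eq)
  moreover have "(\<lambda>k. z ^ k) ` {..<n} \<subseteq> {z. z ^ n = 1}"
    using zn by (auto simp: power_commuting_commutes) (metis mult.commute power_mult power_one)
  moreover have "finite {z::complex. z ^ n = 1}" using n by (intro finite_roots_unity) auto
  ultimately have "(\<lambda>k. z ^ k) ` {..<n} = {z. z ^ n = 1}" by (simp add: card_subset_eq)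
  then obtain k where k: "w = z ^ k" using wn by auto
  define d where "d = gcd k n"
  have d: "d > 0" "d dvd k" "d dvd n" using n by (auto simp: d_def)
  have "w ^ (n div d) = z ^ (k * (n div d))" by (simp add: k power_mult)
  also have "k * (n div d) = n * (k div d)"
    using d by (metis div_mult_swap mult.commute)
  also have "z ^ \<dots> = 1" by (simp add: power_mult zn)
  finally have "w ^ (n div d) = 1" .
  moreover have "n div d > 0" using d n by (auto simp: dvd_div_eq_0_iff)
  ultimately have "\<not> n div d < n" using w_min by blast
  then have "d = 1" using d n by (metis div_less_dividend less_one linorder_neqE_nat less_numeral_extra(3) not_less_zero)
  then show ?thesis using k by (auto simp: d_def coprime_iff_gcd_eq_1)
qed

lemma clear_denominators:
  fixes p :: "rat poly"
  shows "\<exists>c q. c \<noteq> 0 \<and> smult (of_int c) p = map_poly of_int q"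
proof (induction p)
  case 0
  show ?case by (rule exI[of _ 1], rule exI[of _ 0]) simp
next
  case (pCons a p)
  then obtain c q where c: "c \<noteq> 0" and q: "smult (of_int c) p = map_poly of_int q" by blast
  obtain r s where a: "a = of_int r / of_int s" and s: "s > 0"
    by (metis quotient_of_div quotient_of_denom_pos surj_pair)
  have "smult (of_int (s * c)) (pCons a p) = pCons (of_int (r * c)) (smult (of_int s) (smult (of_int c) p))"
    using s by (simp add: a)
  also have "\<dots> = map_poly of_int (pCons (r * c) (smult s q))"
    by (simp add: q hom_distribs)
  finally show ?case using c s by (intro exI[of _ "s * c"] exI conjI) auto
qed

lemma of_rat_poly_of_int_poly:
  "map_poly of_rat (map_poly of_int p) = (map_poly of_int p :: 'a::field_char_0 poly)"
  by (rule poly_eqI) (simp add: coeff_map_poly)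

text \<open>The witness is the monic minimal polynomial of \<open>z\<close>. Its roots are exactly
  the primitive \<open>n\<close>-th roots of unity, one inclusion by
  \<open>root_power_coprime\<close> and the other because conjugates have equal order, and they are
  simple. This also supplies the rational coefficients, which the product over complex roots does
  not show.\<close>

lemma cyclotomic_dvd_of_root:
  assumes z: "z \<in> primitive_roots_of_unity n" and n: "n > 0"
  shows "\<exists>c. is_cyclotomic c \<and> poly (map_poly of_rat c) z = 0 \<and>
    (\<forall>p. poly (map_poly of_rat p) z = 0 \<longrightarrow> c dvd p)"
proof -
  have zn: "z ^ n = 1" and z_min: "\<And>m. 0 < m \<Longrightarrow> m < n \<Longrightarrow> z ^ m \<noteq> 1"
    using z by (auto simp: primitive_roots_of_unity_def)
  have root_x: "poly (map_poly of_int (monom 1 m - 1 :: int poly)) w = w ^ m - 1" for m and w :: complex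
    by (simp add: hom_distribs poly_monom)
  define x where "x = (monom 1 n - 1 :: int poly)"
  have x0: "x \<noteq> 0" using n by (auto simp: x_def monom_eq_1_iff)
  obtain f where f: "int_minimal f z" using int_minimal_exists[OF x0] root_x[of n z] zn by (auto simp: x_def)
  have fz: "poly (map_poly of_int f) z = 0" and f0: "f \<noteq> 0"
    and fdvd: "\<And>h. poly (map_poly of_int h) z = 0 \<Longrightarrow> f dvd h"
    using f by (auto simp: int_minimal_def)
  obtain g where g: "x = f * g" using fdvd[of x] root_x[of n z] zn by (auto simp: dvd_def x_def)
  have root_f: "w ^ n = 1" if "poly (map_poly of_int f) w = 0" for w :: complex
    using root_x[of n w] that by (simp add: g hom_distribs flip: x_def)
  have "lead_coeff x = 1"
    using n lead_coeff_add_le[of "- 1" "monom (1::int) n"] by (simp add: x_def degree_monom_eq)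
  then have "lead_coeff f * lead_coeff g = 1" by (simp add: g lead_coeff_mult)
  then have lf: "lead_coeff f = 1 \<or> lead_coeff f = - 1" by (simp add: zmult_eq_1_iff) blast
  \<comment> \<open>The leading coefficient is 1 or -1, so multiplying by it makes \<open>f\<close>
    monic without leaving the integers.\<close>
  define F where "F = smult (lead_coeff f) f"
  have F1: "lead_coeff F = 1" using lf by (auto simp: F_def)
  define Fc where "Fc = (map_poly of_int F :: complex poly)"
  have Fc0: "Fc \<noteq> 0" and Fc1: "lead_coeff Fc = 1" using F1 f0 by (auto simp: Fc_def)
  have Fc_root: "poly Fc w = 0 \<longleftrightarrow> poly (map_poly of_int f) w = 0" for w
    using f0 by (simp add: Fc_def F_def hom_distribs)
  have "poly Fc w = 0 \<longleftrightarrow> w \<in> primitive_roots_of_unity n" for w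
  proof
    assume "poly Fc w = 0"
    then have fw: "poly (map_poly of_int f) w = 0" by (simp add: Fc_root)
    \<comment> \<open>A root \<open>w\<close> with \<open>w ^ m = 1\<close> would have a minimal
      polynomial that divides \<open>X ^ m - 1\<close> and vanishes at \<open>z\<close>, against the
      order of \<open>z\<close> being \<open>n\<close>.\<close>
    have "w ^ m \<noteq> 1" if m: "0 < m" "m < n" for m
    proof
      assume wm: "w ^ m = 1"
      have "monom 1 m - 1 \<noteq> (0::int poly)" using m by (auto simp: monom_eq_1_iff)
      then obtain h where h: "int_minimal h w"
        using int_minimal_exists[of "monom 1 m - 1"] root_x[of m w] wm by auto
      have "h dvd monom 1 m - 1" using h root_x[of m w] wm by (auto simp: int_minimal_def)
      moreover have "poly (map_poly of_int h) z = 0" using int_minimal_unique[OF f h fw] .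
      ultimately have "poly (map_poly of_int (monom 1 m - 1)) z = 0"
        by (metis dvdE of_int_poly_hom.hom_mult poly_mult mult_zero_left)
      then have "z ^ m - 1 = 0" unfolding root_x .
      then show False using z_min m by simp
    qed
    then show "w \<in> primitive_roots_of_unity n"
      using root_f[OF fw] by (auto simp: primitive_roots_of_unity_def)
  next
    assume "w \<in> primitive_roots_of_unity n"
    then obtain k where k: "coprime k n" "w = z ^ k"
      using primitive_roots_of_unity_power_coprime[OF z _ n] by blast
    then show "poly Fc w = 0" using root_power_coprime[OF k(1) n zn fz] by (simp add: Fc_root)
  qed
  then have roots: "{w. poly Fc w = 0} = primitive_roots_of_unity n" by blast
  \<comment> \<open>A double root of \<open>Fc\<close> would be a double root of
    \<open>X ^ n - 1\<close>, whose derivative can vanish only at 0.\<close>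
  have "rsquarefree Fc"
    unfolding rsquarefree_roots
  proof (intro allI notI)
    fix a assume a: "poly Fc a = 0 \<and> poly (pderiv Fc) a = 0"
    define X where "X = (monom 1 n - 1 :: complex poly)"
    have X: "smult (of_int (lead_coeff f)) X = Fc * map_poly of_int g"
      using arg_cong[OF g, of "\<lambda>q. smult (of_int (lead_coeff f)) (map_poly of_int q :: complex poly)"]
      by (simp add: X_def x_def Fc_def F_def hom_distribs)
    have "poly (pderiv (smult (of_int (lead_coeff f)) X)) a = 0"
      unfolding X using a by (simp add: pderiv_mult)
    then have "of_nat n * a ^ (n - 1) = 0"
      using f0 by (simp add: X_def pderiv_smult pderiv_diff pderiv_monom poly_monom)
    then have "a = 0" using n by auto
    moreover have "a ^ n = 1" using a root_f Fc_root by blast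
    ultimately show False using n by (simp add: power_0_left)
  qed
  then have Fc_prod: "Fc = (\<Prod>z\<in>primitive_roots_of_unity n. [:- z, 1:])"
    using complex_poly_decompose_rsquarefree[of Fc] Fc1 roots by simp
  define c where "c = (map_poly of_int F :: rat poly)"
  have c_Fc: "map_poly of_rat c = Fc" by (simp add: c_def Fc_def of_rat_poly_of_int_poly)
  have "is_cyclotomic c" unfolding is_cyclotomic_def using n c_Fc Fc_prod by auto
  moreover have "poly (map_poly of_rat c) z = 0" using c_Fc Fc_root fz by simp
  moreover have "c dvd p" if p: "poly (map_poly of_rat p) z = 0" for p
  proof -
    obtain d q where d: "d \<noteq> 0" and q: "smult (of_int d) p = map_poly of_int q"
      using clear_denominators by blast
    have "poly (map_poly of_rat (smult (of_int d) p)) z = 0" using p by (simp add: hom_distribs)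
    then have "f dvd q" unfolding q of_rat_poly_of_int_poly by (rule fdvd)
    then have "F dvd q" using lf by (auto simp: F_def)
    then have "c dvd smult (of_int d) p" unfolding q c_def by (rule of_int_poly_hom.hom_dvd)
    then show ?thesis using d by (simp add: dvd_smult_iff)
  qed
  ultimately show ?thesis by blast
qed

text \<open>By induction on the degree, a complex root is chosen and a rational factor split off:
  \<open>X\<close> for the root 0, and for a root of unity the cyclotomic polynomial of its order.
  The quotient inherits the hypothesis on the roots.\<close>

lemma cyclotomic_factorization:
  fixes p :: "rat poly"
  assumes "p \<noteq> 0" "\<And>z. poly (map_poly of_rat p) z = 0 \<Longrightarrow> z = 0 \<or> (\<exists>n>0. z ^ n = (1::complex))"
  shows "\<exists>c e ps. c \<noteq> 0 \<and> (\<forall>q\<in>set ps. is_cyclotomic q) \<and> p = smult c (monom 1 e * prod_list ps)"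
  using assms
proof (induction "degree p" arbitrary: p rule: less_induct)
  case less
  have step: "\<exists>c e ps. c \<noteq> 0 \<and> (\<forall>q\<in>set ps. is_cyclotomic q) \<and> q = smult c (monom 1 e * prod_list ps)"
    if "p = f * q" and f: "poly (map_poly of_rat f) z = (0::complex)" for f q z
  proof (rule less.hyps)
    have nz: "f \<noteq> 0" "q \<noteq> 0" using that less.prems by auto
    have "degree f > 0"
    proof (rule ccontr)
      assume "\<not> degree f > 0"
      then obtain a where "f = [:a:]" by (auto elim: degree_eq_zeroE)
      with f nz show False by simp
    qed
    then show "degree q < degree p" using nz that by (simp add: degree_mult_eq)
    show "q \<noteq> 0" by (rule nz)
    show "z = 0 \<or> (\<exists>n>0. z ^ n = 1)" if "poly (map_poly of_rat q) z = 0" for z :: complex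
      using less.prems(2)[of z] that unfolding \<open>p = f * q\<close>
      by (simp add: of_rat_poly_hom.hom_mult)
  qed
  show ?case
  proof (cases "degree p = 0")
    case True
    then obtain a where a: "p = [:a:]" by (auto elim: degree_eq_zeroE)
    then show ?thesis using less.prems by (intro exI[of _ a] exI[of _ 0] exI[of _ "[]"]) auto
  next
    case False
    then have "\<not> constant (poly (map_poly of_rat p :: complex poly))" by (simp add: constant_degree)
    then obtain z :: complex where z: "poly (map_poly of_rat p) z = 0"
      using fundamental_theorem_of_algebra by blast
    show ?thesis
    proof (cases "z = 0")
      case True
      then have "poly p 0 = 0" using z by (simp add: poly_0_coeff_0 coeff_map_poly)
      then obtain q where q: "p = [:0, 1:] * q" by (auto simp: poly_eq_0_iff_dvd dvd_def)
      then obtain c e ps where *: "c \<noteq> 0" "\<forall>q\<in>set ps. is_cyclotomic q"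
        "q = smult c (monom 1 e * prod_list ps)"
        using step[of "[:0, 1:]" q 0] by (auto simp: hom_distribs)
      then have "p = smult c (monom 1 (Suc e) * prod_list ps)"
        by (simp add: q monom_Suc)
      then show ?thesis using * by blast
    next
      case False
      then obtain n where n: "n > 0" "z \<in> primitive_roots_of_unity n"
        using less.prems(2)[OF z] primitive_root_of_unity_exists by blast
      obtain f where f: "is_cyclotomic f" "poly (map_poly of_rat f) z = 0" "f dvd p"
        using cyclotomic_dvd_of_root[OF n(2,1)] z by blast
      then obtain q where q: "p = f * q" by (auto simp: dvd_def)
      then obtain c e ps where *: "c \<noteq> 0" "\<forall>q\<in>set ps. is_cyclotomic q"
        "q = smult c (monom 1 e * prod_list ps)"
        using step[OF q f(2)] by blast
      then have "p = smult c (monom 1 e * prod_list (f # ps))"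
        by (simp add: q ac_simps)
      moreover have "\<forall>q\<in>set (f # ps). is_cyclotomic q" using * f by simp
      ultimately show ?thesis using * by blast
    qed
  qed
qed

text \<open>Reflecting \<open>X - z\<close> gives \<open>1 - z X = - z (X - 1 / z)\<close>, and
  inversion permutes the primitive \<open>n\<close>-th roots. The constant is the product of the
  \<open>- z\<close>, that is, the constant coefficient of \<open>p\<close>.\<close>

lemma cyclotomic_reflect:
  assumes "is_cyclotomic p"
  shows "\<exists>c\<noteq>0. reflect_poly p = smult c p"
proof -
  obtain n where n: "n > 0" and p: "map_poly of_rat p = (\<Prod>z\<in>primitive_roots_of_unity n. [:- z, 1:])"
    using assms by (auto simp: is_cyclotomic_def)
  let ?S = "primitive_roots_of_unity n"
  have nz: "z \<noteq> 0" if "z \<in> ?S" for z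
    using that n by (auto simp: primitive_roots_of_unity_def power_0_left)
  have inv: "bij_betw inverse ?S ?S"
    by (rule bij_betwI[where g = inverse])
      (auto simp: primitive_roots_of_unity_def power_inverse)
  have "map_poly of_rat (reflect_poly p) = reflect_poly (map_poly of_rat p :: complex poly)"
    by (rule poly_eqI) (simp add: coeff_reflect_poly coeff_map_poly)
  also have "\<dots> = (\<Prod>z\<in>?S. reflect_poly [:- z, 1:])" unfolding p by (rule reflect_poly_prod)
  also have "\<dots> = (\<Prod>z\<in>?S. [:- z:] * [:- inverse z, 1:])"
    using nz by (intro prod.cong) (auto simp: reflect_poly_pCons)
  also have "\<dots> = (\<Prod>z\<in>?S. [:- z:]) * (\<Prod>z\<in>?S. [:- inverse z, 1:])" by (rule prod.distrib)
  also have "(\<Prod>z\<in>?S. [:- inverse z, 1:]) = map_poly of_rat p"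
    unfolding p using prod.reindex_bij_betw[OF inv, of "\<lambda>z. [:- z, 1:]"] by simp
  also have "(\<Prod>z\<in>?S. [:- z:]) = [:\<Prod>z\<in>?S. - z:]"
    by (induction rule: infinite_finite_induct) (auto simp: one_pCons)
  also have "(\<Prod>z\<in>?S. - z) = poly (map_poly of_rat p) 0"
    by (simp add: p poly_prod)
  also have "\<dots> = of_rat (coeff p 0)" by (simp add: poly_0_coeff_0 coeff_map_poly)
  finally have eq: "map_poly of_rat (reflect_poly p) = (map_poly of_rat (smult (coeff p 0) p) :: complex poly)"
    by (simp add: hom_distribs)
  then have r: "reflect_poly p = smult (coeff p 0) p" by (rule of_rat_poly_hom.injectivity)
  have "(of_rat (coeff p 0) :: complex) = (\<Prod>z\<in>?S. - z)"
    by (simp add: p poly_prod flip: \<open>_ = of_rat (coeff p 0)\<close>)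
  also have "\<dots> \<noteq> 0" using nz finite_primitive_roots_of_unity[OF n] by simp
  finally show ?thesis using r by auto
qed

section \<open>Laurent polynomials\<close>

lemma lookup_single_times:
  fixes q :: "'a::ab_group_add \<Rightarrow>\<^sub>0 'b::comm_semiring_1"
  shows "Poly_Mapping.lookup (Poly_Mapping.single n c * q) k = c * Poly_Mapping.lookup q (k - n)"
proof -
  have "k = n + l \<longleftrightarrow> l = k - n" for l by (auto simp: algebra_simps)
  then have "(\<Sum>l. Poly_Mapping.lookup q l when k = n + l) = Poly_Mapping.lookup q (k - n)"
    by simp
  moreover have "Poly_Mapping.lookup (Poly_Mapping.single n c * q) k =
      (\<Sum>l. (c when n = l) * (\<Sum>j. Poly_Mapping.lookup q j when k = l + j))"
    by (simp add: lookup_mult lookup_single)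
  moreover have "\<dots> = (\<Sum>l. (c * (\<Sum>j. Poly_Mapping.lookup q j when k = l + j)) when n = l)"
    by (intro Sum_any.cong) (auto simp: when_def)
  ultimately show ?thesis by simp
qed

lemma lookup_laurent_of_poly:
  "Poly_Mapping.lookup (laurent_of_poly p) k = (if k \<ge> 0 then coeff p (nat k) else 0)"
proof -
  have "Poly_Mapping.lookup (laurent_of_poly p) k = (\<Sum>i\<le>degree p. coeff p i when int i = k)"
    by (simp add: laurent_of_poly_def lookup_sum lookup_single)
  also have "\<dots> = (\<Sum>i\<le>degree p. if i = nat k then (if k \<ge> 0 then coeff p (nat k) else 0) else 0)"
    by (intro sum.cong) (auto simp: when_def)
  also have "\<dots> = (if k \<ge> 0 then coeff p (nat k) else 0)"
    by (simp add: coeff_eq_0)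
  finally show ?thesis .
qed

lemma laurent_of_poly_eq_iff: "laurent_of_poly p = laurent_of_poly q \<longleftrightarrow> p = q"
proof
  assume eq: "laurent_of_poly p = laurent_of_poly q"
  show "p = q"
  proof (rule poly_eqI)
    fix n
    show "coeff p n = coeff q n"
      using arg_cong[OF eq, of "\<lambda>f. Poly_Mapping.lookup f (int n)"] by (simp add: lookup_laurent_of_poly)
  qed
qed simp

lemma laurent_of_poly_0: "laurent_of_poly 0 = 0"
  and laurent_of_poly_add: "laurent_of_poly (p + q) = laurent_of_poly p + laurent_of_poly q"
  and laurent_of_poly_diff: "laurent_of_poly (p - q) = laurent_of_poly p - laurent_of_poly q"
  and laurent_of_poly_smult: "laurent_of_poly (smult c p) = lconst c * laurent_of_poly p"
  and laurent_of_poly_pCons: "laurent_of_poly (pCons c p) = lconst c + tpow 1 * laurent_of_poly p"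
  and laurent_of_poly_monom: "laurent_of_poly (monom c n) = Poly_Mapping.single (int n) c"
  by (rule poly_mapping_eqI; auto simp: lookup_laurent_of_poly lookup_add lookup_minus
      lookup_single_times lookup_single when_def coeff_pCons nat_diff_distrib split: nat.split)+

lemma laurent_of_poly_1: "laurent_of_poly 1 = 1"
  using laurent_of_poly_monom[of 1 0] by simp

lemma laurent_of_poly_mult: "laurent_of_poly (p * q) = laurent_of_poly p * laurent_of_poly q"
  by (induction p)
    (simp_all add: laurent_of_poly_0 laurent_of_poly_add laurent_of_poly_smult laurent_of_poly_pCons
      algebra_simps)

lemma laurent_of_poly_power: "laurent_of_poly (p ^ n) = laurent_of_poly p ^ n"
  by (induction n) (simp_all add: laurent_of_poly_1 laurent_of_poly_mult)

lemma tpow_add: "tpow (m + n) = tpow m * tpow n"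
  by (simp add: mult_single)

text \<open>Dividing by \<open>t ^ n\<close>, for a lower bound \<open>n\<close> of the exponents,
  leaves no negative ones. Through this, factorization and Bezout identities carry over from
  \<open>Q[t]\<close>.\<close>

lemma laurent_eq_tpow_times_poly:
  fixes f :: laurent
  shows "\<exists>n p. f = tpow n * laurent_of_poly p"
proof -
  obtain n where n: "\<And>k. k \<in> Poly_Mapping.keys f \<Longrightarrow> n \<le> k"
    using Min_le[of "Poly_Mapping.keys f"] finite_keys[of f] by blast
  define p where "p = (\<Sum>k\<in>Poly_Mapping.keys f. monom (Poly_Mapping.lookup f k) (nat (k - n)))"
  have "f = tpow n * laurent_of_poly p"
  proof (rule poly_mapping_eqI)
    fix k
    have "coeff p (nat (k - n)) = Poly_Mapping.lookup f k" if "k \<ge> n"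
    proof -
      have "coeff p (nat (k - n)) = (\<Sum>j\<in>Poly_Mapping.keys f. if j = k then Poly_Mapping.lookup f k else 0)"
        unfolding p_def coeff_sum
      proof (rule sum.cong)
        fix j assume "j \<in> Poly_Mapping.keys f"
        then have "nat (j - n) = nat (k - n) \<longleftrightarrow> j = k" using n[of j] that by auto
        then show "coeff (monom (Poly_Mapping.lookup f j) (nat (j - n))) (nat (k - n)) =
            (if j = k then Poly_Mapping.lookup f k else 0)" by auto
      qed simp
      also have "\<dots> = Poly_Mapping.lookup f k" by (simp add: in_keys_iff)
      finally show ?thesis .
    qed
    moreover have "Poly_Mapping.lookup f k = 0" if "\<not> k \<ge> n"
      using n that by (meson in_keys_iff)
    ultimately show "Poly_Mapping.lookup f k = Poly_Mapping.lookup (tpow n * laurent_of_poly p) k"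
      by (simp add: lookup_single_times lookup_laurent_of_poly)
  qed
  then show ?thesis by blast
qed

lemma tpow_minus_cancel: "tpow (- n) * (tpow n * f) = f"
  by (simp add: mult_single flip: mult.assoc)

text \<open>\<open>reflect_poly p\<close> is \<open>t ^ (degree p)\<close> times
  \<open>p(1 / t)\<close>, which accounts for the shift by the degree.\<close>

lemma subst_inverse_single_times:
  "subst_inverse (Poly_Mapping.single n c * laurent_of_poly p) =
    Poly_Mapping.single (- n - int (degree p)) c * laurent_of_poly (reflect_poly p)"
proof (rule poly_mapping_eqI)
  fix k
  have "inj (uminus :: int \<Rightarrow> int)" by (simp add: inj_on_def)
  then have "Poly_Mapping.lookup (subst_inverse (Poly_Mapping.single n c * laurent_of_poly p)) k
      = c * Poly_Mapping.lookup (laurent_of_poly p) (- k - n)"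
    by (simp add: subst_inverse_def map_key.rep_eq lookup_single_times)
  also have "Poly_Mapping.lookup (laurent_of_poly p) (- k - n)
      = Poly_Mapping.lookup (laurent_of_poly (reflect_poly p)) (k - (- n - int (degree p)))"
    by (auto simp: lookup_laurent_of_poly coeff_reflect_poly nat_diff_distrib' coeff_eq_0
        intro!: arg_cong[of _ _ "coeff p"])
  finally show "Poly_Mapping.lookup (subst_inverse (Poly_Mapping.single n c * laurent_of_poly p)) k
      = Poly_Mapping.lookup (Poly_Mapping.single (- n - int (degree p)) c
          * laurent_of_poly (reflect_poly p)) k"
    by (simp add: lookup_single_times)
qed

text \<open>Once powers of \<open>t\<close> are cleared, the polynomial part \<open>p\<close> of
  \<open>f\<close> divides \<open>t ^ j * (t ^ N - 1) ^ m\<close> in \<open>Q[t]\<close>. Its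
  complex roots are thus 0 or roots of unity.\<close>

lemma laurent_dvd_power_factorization:
  assumes dvd: "f dvd (tpow (int N) - 1) ^ m" and N: "N > 0"
  shows "\<exists>n c ps. c \<noteq> 0 \<and> (\<forall>q\<in>set ps. is_cyclotomic q) \<and>
    f = Poly_Mapping.single n c * laurent_of_poly (prod_list ps)"
proof -
  obtain g where g: "(tpow (int N) - 1) ^ m = f * g" using dvd by (auto simp: dvd_def)
  obtain a p where f: "f = tpow a * laurent_of_poly p" using laurent_eq_tpow_times_poly by blast
  obtain b q where gq: "g = tpow b * laurent_of_poly q" using laurent_eq_tpow_times_poly by blast
  \<comment> \<open>The positive and negative parts of \<open>a + b\<close>, placed on opposite
    sides so that both become polynomials.\<close>
  define i j where "i = nat (a + b)" and "j = nat (- (a + b))"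
  define X where "X = (monom 1 N - 1 :: rat poly)"
  have X: "laurent_of_poly X = tpow (int N) - 1"
    by (simp add: X_def laurent_of_poly_diff laurent_of_poly_monom laurent_of_poly_1)
  have ij: "tpow (int j) * tpow (a + b) = tpow (int i)"
    by (cases "a + b \<ge> 0") (simp_all add: mult_single i_def j_def)
  have "laurent_of_poly (monom 1 j * X ^ m) = tpow (int j) * (f * g)"
    by (simp add: laurent_of_poly_mult laurent_of_poly_power laurent_of_poly_monom X g)
  also have "\<dots> = tpow (int j) * tpow (a + b) * laurent_of_poly (p * q)"
    unfolding f gq tpow_add laurent_of_poly_mult by (simp only: ac_simps)
  also have "\<dots> = laurent_of_poly (monom 1 i * (p * q))"
    unfolding ij by (simp add: laurent_of_poly_mult laurent_of_poly_monom)
  finally have eq: "monom 1 j * X ^ m = monom 1 i * (p * q)" by (simp add: laurent_of_poly_eq_iff)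
  have "X \<noteq> 0" using N by (auto simp: X_def monom_eq_1_iff)
  then have p0: "p \<noteq> 0" using eq by (auto simp: monom_eq_0_iff)
  have roots: "z = 0 \<or> (\<exists>n>0. z ^ n = 1)" if z: "poly (map_poly of_rat p) z = 0" for z :: complex
  proof -
    have "poly (map_poly of_rat (monom 1 j * X ^ m)) z = 0"
      unfolding eq using z by (simp add: of_rat_poly_hom.hom_mult)
    then have "z ^ j * (z ^ N - 1) ^ m = 0"
      by (simp add: X_def of_rat_poly_hom.hom_mult of_rat_poly_hom.hom_power of_rat_poly_hom.hom_minus poly_monom)
    then show ?thesis using N by auto
  qed
  obtain c e ps where c: "c \<noteq> 0" "\<forall>q\<in>set ps. is_cyclotomic q" "p = smult c (monom 1 e * prod_list ps)"
    using cyclotomic_factorization[OF p0 roots] by blast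
  have "f = Poly_Mapping.single (a + int e) c * laurent_of_poly (prod_list ps)"
    unfolding f c(3) laurent_of_poly_smult laurent_of_poly_mult laurent_of_poly_monom
    by (simp add: mult_single flip: mult.assoc)
  then show ?thesis using c by blast
qed

lemma reflect_prod_list_cyclotomic:
  assumes "\<forall>q\<in>set ps. is_cyclotomic q"
  shows "\<exists>c\<noteq>0. reflect_poly (prod_list ps) = smult c (prod_list ps)"
  using assms
proof (induction ps)
  case Nil
  show ?case by (intro exI[of _ 1]) simp
next
  case (Cons p ps)
  then obtain c where c: "c \<noteq> 0" "reflect_poly (prod_list ps) = smult c (prod_list ps)" by auto
  obtain d where d: "d \<noteq> 0" "reflect_poly p = smult d p" using Cons.prems cyclotomic_reflect by auto
  show ?case using c d by (intro exI[of _ "d * c"]) (simp add: reflect_poly_mult mult.commute)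
qed

lemma cyclotomic_and_reciprocal_of_dvd:
  assumes dvd: "f dvd (tpow (int N) - 1) ^ m" and N: "N > 0"
  shows "(\<exists>m P. is_product_of_cyclotomics P \<and> f \<doteq> (1 - tpow 1) ^ m * P) \<and> f \<doteq> subst_inverse f"
proof -
  obtain n c ps where c: "c \<noteq> 0" and ps: "\<forall>q\<in>set ps. is_cyclotomic q"
    and f: "f = Poly_Mapping.single n c * laurent_of_poly (prod_list ps)"
    using laurent_dvd_power_factorization[OF assms] by blast
  have unit: "Poly_Mapping.single k a dvd (1::laurent)" if "a \<noteq> 0" for k :: int and a :: rat
  proof
    show "1 = Poly_Mapping.single k a * Poly_Mapping.single (- k) (1 / a)"
      using that by (simp add: mult_single)
  qed
  have "f \<doteq> (1 - tpow 1) ^ 0 * laurent_of_poly (prod_list ps)"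
    unfolding eq_up_to_unit_def using unit[OF c] f by auto
  moreover have "is_product_of_cyclotomics (laurent_of_poly (prod_list ps))"
    unfolding is_product_of_cyclotomics_def using ps by blast
  moreover have "f \<doteq> subst_inverse f"
  proof -
    obtain d where d: "d \<noteq> 0" "reflect_poly (prod_list ps) = smult d (prod_list ps)"
      using reflect_prod_list_cyclotomic[OF ps] by blast
    define k where "k = - n - int (degree (prod_list ps))"
    have "subst_inverse f = Poly_Mapping.single k c * (lconst d * laurent_of_poly (prod_list ps))"
      by (simp add: f subst_inverse_single_times d laurent_of_poly_smult k_def)
    \<comment> \<open>\<open>f\<close> and \<open>subst_inverse f\<close> are the monomials
      \<open>c t ^ n\<close> and \<open>c d t ^ k\<close> times the same polynomial; the unit is
      their quotient.\<close>
    then have "Poly_Mapping.single (n - k) (1 / d) * subst_inverse f = f"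
      using d by (simp add: f mult_single flip: mult.assoc)
    then show ?thesis unfolding eq_up_to_unit_def using unit[of "1 / d" "n - k"] d
      by (intro exI[of _ "Poly_Mapping.single (n - k) (1 / d)"]) simp
  qed
  ultimately show ?thesis by blast
qed

section \<open>Bezout identities and greatest common divisors of Laurent polynomials\<close>

lemma poly_bezout:
  fixes p q :: "'a::field poly"
  shows "\<exists>d u v. d dvd p \<and> d dvd q \<and> d = u * p + v * q"
\<comment> \<open>Euclid's algorithm. The successor in the measure separates nonzero constants from
  0, both of degree 0.\<close>
proof (induction "if q = 0 then 0 else Suc (degree q)" arbitrary: p q rule: less_induct)
  case less
  show ?case
  proof (cases "q = 0")
    case True
    then show ?thesis by (intro exI[of _ p] exI[of _ 1] exI[of _ 0]) simp
  next
    case False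
    then have "(if p mod q = 0 then 0 else Suc (degree (p mod q))) < (if q = 0 then 0 else Suc (degree q))"
      using degree_mod_less[of q p] by auto
    from less[OF this] obtain d u v where d: "d dvd q" "d dvd p mod q" "d = u * q + v * (p mod q)"
      by blast
    have "d dvd p" using d(1,2) by (simp add: dvd_mod_iff)
    moreover have "d = v * p + (u - v * (p div q)) * q"
      unfolding d(3) by (simp add: algebra_simps flip: minus_div_mult_eq_mod)
    ultimately show ?thesis using d(1) by blast
  qed
qed

text \<open>Powers of \<open>t\<close> are units: they are factored out of \<open>a\<close> and
  \<open>b\<close>, and their inverses are absorbed into the coefficients of the
  combination.\<close>

lemma laurent_bezout:
  fixes a b :: laurent
  shows "\<exists>d u v. d dvd a \<and> d dvd b \<and> d = u * a + v * b"
proof -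
  obtain m p where a: "a = tpow m * laurent_of_poly p" using laurent_eq_tpow_times_poly by blast
  obtain n q where b: "b = tpow n * laurent_of_poly q" using laurent_eq_tpow_times_poly by blast
  obtain g u v where g: "g dvd p" "g dvd q" and uv: "g = u * p + v * q" using poly_bezout by blast
  define d where "d = laurent_of_poly g"
  have L_dvd: "laurent_of_poly r dvd laurent_of_poly s" if "r dvd s" for r s
    using that by (auto simp: dvd_def laurent_of_poly_mult)
  have "d dvd a" "d dvd b" unfolding a b d_def by (simp_all add: L_dvd dvd_mult g)
  moreover have "d = (laurent_of_poly u * tpow (- m)) * a + (laurent_of_poly v * tpow (- n)) * b"
    unfolding a b mult.assoc tpow_minus_cancel d_def uv
    by (simp add: laurent_of_poly_add laurent_of_poly_mult)
  ultimately show ?thesis by blast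
qed

text \<open>A common divisor of the form \<open>u * a + v * b\<close> is divisible by every other
  one, so a greatest common divisor can be built up element by element.\<close>

lemma is_gcd_of_exists:
  fixes S :: "laurent set"
  assumes "finite S"
  shows "\<exists>d. is_gcd_of S d"
  using assms
proof induction
  case empty
  \<comment> \<open>The value 0 for the empty set is the order when there are fewer relations than
    generators.\<close>
  show ?case by (rule exI[of _ 0]) (simp add: is_gcd_of_def)
next
  case (insert a S)
  then obtain b where b: "is_gcd_of S b" by blast
  obtain d u v where d: "d dvd a" "d dvd b" "d = u * a + v * b" using laurent_bezout by blast
  have "is_gcd_of (insert a S) d"
    using b d by (auto simp: is_gcd_of_def intro: dvd_trans)
  then show ?case by blast
qed

section \<open>Annihilators and maximal minors\<close>

text \<open>A repeated column makes the determinant vanish. Otherwise the chosen columns are those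
  of a maximal square submatrix in another order, and the determinant is a maximal minor up to
  sign.\<close>

lemma dvd_det_of_dvd_maximal_minors:
  fixes A :: "'r::comm_ring_1 mat"
  assumes A: "A \<in> carrier_mat m n" and f: "f \<in> {0..<m} \<rightarrow> {0..<n}"
    and d: "\<And>a. a \<in> maximal_minors A \<Longrightarrow> d dvd a"
  shows "d dvd det (mat\<^sub>r m m (\<lambda>i. col A (f i)))"
proof (cases "inj_on f {0..<m}")
  case False
  then obtain i j where ij: "f i = f j" "i \<noteq> j" "i < m" "j < m" by (auto simp: inj_on_def)
  have "det (mat\<^sub>r m m (\<lambda>i. col A (f i))) = 0"
    using ij A by (intro det_identical_rows[where i = i and j = j and n = m]) auto
  then show ?thesis by simp
next
  case True
  define J where "J = f ` {0..<m}"
  have J: "J \<subseteq> {..<n}" "card J = m" "finite J" using f True by (auto simp: J_def card_image)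
  define S where "S = submatrix A UNIV J"
  have J_eq: "{j. j < n \<and> j \<in> J} = J" using J by auto
  have S: "S \<in> carrier_mat m m"
    using A J by (intro carrier_matI) (simp_all add: S_def dim_submatrix J_eq)
  have "det S \<in> maximal_minors A"
    unfolding maximal_minors_def S_def using A J by auto
  then have dS: "d dvd det S" by (rule d)
  \<comment> \<open>The rank of \<open>f i\<close> within \<open>J\<close> is the position of that
    column in the submatrix, which lists the columns of \<open>J\<close> in increasing order.
    Outside the range \<open>p\<close> is the identity, as \<open>permutes\<close> demands.\<close>
  define p where "p = (\<lambda>i. if i < m then card {a \<in> J. a < f i} else i)"
  have pick: "pick J (p i) = f i" if "i < m" for i
    using that pick_card_in_set[of "f i" J] by (simp add: p_def J_def)
  have pm: "p i < m" if "i < m" for i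
  proof -
    have "{a \<in> J. a < f i} \<subset> J" using that by (auto simp: J_def)
    then show ?thesis using J that psubset_card_mono[of J "{a \<in> J. a < f i}"] by (simp add: p_def)
  qed
  have "inj_on p {0..<m}"
  proof (rule inj_onI)
    fix i j assume "i \<in> {0..<m}" "j \<in> {0..<m}" "p i = p j"
    then have "f i = f j" using pick[of i] pick[of j] by simp
    then show "i = j" using True \<open>i \<in> _\<close> \<open>j \<in> _\<close> by (auto dest: inj_onD)
  qed
  then have p: "p permutes {0..<m}" using pm by (intro inj_on_nat_permutes) (auto simp: p_def)
  have "mat\<^sub>r m m (\<lambda>i. col A (f i)) = mat m m (\<lambda>(i, j). S\<^sup>T $$ (p i, j))"
  proof (rule eq_matI)
    fix i j assume "i < dim_row (mat m m (\<lambda>(i, j). S\<^sup>T $$ (p i, j)))"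
      "j < dim_col (mat m m (\<lambda>(i, j). S\<^sup>T $$ (p i, j)))"
    then have ij: "i < m" "j < m" by auto
    have "f i < n" using f ij by auto
    have "S $$ (j, p i) = A $$ (pick UNIV j, pick J (p i))"
      unfolding S_def using A J ij pm[OF ij(1)] by (intro submatrix_index) (auto simp: J_eq)
    then show "mat\<^sub>r m m (\<lambda>i. col A (f i)) $$ (i, j) = mat m m (\<lambda>(i, j). S\<^sup>T $$ (p i, j)) $$ (i, j)"
      using ij S pm[OF ij(1)] A \<open>f i < n\<close> by (simp add: pick_UNIV pick)
  qed auto
  also have "det \<dots> = signof p * det S\<^sup>T" by (rule det_permute_rows) (use S p in auto)
  finally show ?thesis using dS det_transpose[OF S] by simp
qed

text \<open>The columns of \<open>A * X\<close> are combinations of columns of \<open>A\<close>.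
  Multilinear expansion, carried out on the rows of the transpose, gives a sum over all choices
  \<open>f\<close> of columns of \<open>A\<close>, as in the Cauchy-Binet formula.\<close>

lemma dvd_det_mult_of_dvd_maximal_minors:
  fixes A :: "'r::comm_ring_1 mat"
  assumes A: "A \<in> carrier_mat m n" and X: "X \<in> carrier_mat n m"
    and d: "\<And>a. a \<in> maximal_minors A \<Longrightarrow> d dvd a"
  shows "d dvd det (A * X)"
proof -
  have AX: "A * X \<in> carrier_mat m m" using A X by auto
  have carr: "(\<lambda>i k. X\<^sup>T $$ (i, k) \<cdot>\<^sub>v row A\<^sup>T k) \<in> {0..<m} \<rightarrow> {0..<n} \<rightarrow> carrier_vec m"
    using A by auto
  have "det (A * X) = det (X\<^sup>T * A\<^sup>T)"
    using det_transpose[OF AX] transpose_mult[OF A X] by simp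
  also have "X\<^sup>T * A\<^sup>T = mat\<^sub>r m m (\<lambda>i. finsum_vec TYPE('r) m (\<lambda>k. X\<^sup>T $$ (i, k) \<cdot>\<^sub>v row A\<^sup>T k) {0..<n})"
    using A X by (intro mat_mul_finsum_alt) auto
  also have "det \<dots> = (\<Sum>f\<in>{f. (\<forall>i\<in>{0..<m}. f i \<in> {0..<n}) \<and> (\<forall>i. i \<notin> {0..<m} \<longrightarrow> f i = i)}.
      det (mat\<^sub>r m m (\<lambda>i. X\<^sup>T $$ (i, f i) \<cdot>\<^sub>v row A\<^sup>T (f i))))"
    by (rule det_linear_rows_sum[OF _ carr]) simp
  finally have eq: "det (A * X) = \<dots>" .
  show ?thesis unfolding eq
  proof (rule dvd_sum)
    fix f assume "f \<in> {f. (\<forall>i\<in>{0..<m}. f i \<in> {0..<n}) \<and> (\<forall>i. i \<notin> {0..<m} \<longrightarrow> f i = i)}"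
    then have f: "f \<in> {0..<m} \<rightarrow> {0..<n}" by auto
    have "det (mat\<^sub>r m m (\<lambda>i. X\<^sup>T $$ (i, f i) \<cdot>\<^sub>v row A\<^sup>T (f i)))
        = (\<Prod>i\<in>{0..<m}. X\<^sup>T $$ (i, f i)) * det (mat\<^sub>r m m (\<lambda>i. row A\<^sup>T (f i)))"
      using A f by (intro det_rows_mul) (auto simp: Pi_iff)
    also have "mat\<^sub>r m m (\<lambda>i. row A\<^sup>T (f i)) = mat\<^sub>r m m (\<lambda>i. col A (f i))"
      using f A by (intro eq_rowI) (auto simp: Pi_iff)
    finally show "d dvd det (mat\<^sub>r m m (\<lambda>i. X\<^sup>T $$ (i, f i) \<cdot>\<^sub>v row A\<^sup>T (f i)))"
      using dvd_det_of_dvd_maximal_minors[OF A f d] by simp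
  qed
qed

text \<open>Each \<open>c e_i\<close> maps to zero in \<open>M\<close>, so it lies in the column
  space of \<open>A\<close>; together the preimages form \<open>X\<close> with
  \<open>A X = c I\<close>. The argument works for whichever presentation computes \<open>d\<close>,
  so independence of the presentation does not enter.\<close>

lemma order_dvd_annihilator_power:
  fixes M :: "('r::comm_ring_1, 'm) module"
  assumes ord: "is_order_of M d" and ann: "\<And>x. x \<in> carrier M \<Longrightarrow> c \<odot>\<^bsub>M\<^esub> x = \<zero>\<^bsub>M\<^esub>"
  shows "\<exists>m. d dvd c ^ m"
proof -
  obtain A where pres: "is_presentation_matrix M A" and gcd: "is_gcd_of (maximal_minors A) d"
    using ord by (auto simp: is_order_of_def)
  define m n where "m = dim_row A" and "n = dim_col A"
  have A: "A \<in> carrier_mat m n" by (auto simp: m_def n_def)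
  obtain f where f: "f \<in> epi (add_monoid (module_vec TYPE('r) m)) (add_monoid M)"
    and f_smult: "\<And>r v. v \<in> carrier_vec m \<Longrightarrow> f (r \<cdot>\<^sub>v v) = r \<odot>\<^bsub>M\<^esub> f v"
    and ker: "a_kernel (module_vec TYPE('r) m) M f = (\<lambda>x. A *\<^sub>v x) ` carrier_vec n"
    using pres unfolding is_presentation_matrix_def m_def n_def by blast
  have "\<exists>x \<in> carrier_vec n. A *\<^sub>v x = c \<cdot>\<^sub>v unit_vec m i" for i
  proof -
    have "f (unit_vec m i) \<in> carrier M"
      using f by (auto simp: epi_def hom_def module_vec_simps)
    then have "f (c \<cdot>\<^sub>v unit_vec m i) = \<zero>\<^bsub>M\<^esub>" by (simp add: f_smult ann)
    then have "c \<cdot>\<^sub>v unit_vec m i \<in> a_kernel (module_vec TYPE('r) m) M f"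
      by (simp add: a_kernel_def kernel_def module_vec_simps)
    then show ?thesis unfolding ker by auto
  qed
  then obtain x where x: "\<And>i. x i \<in> carrier_vec n" "\<And>i. A *\<^sub>v x i = c \<cdot>\<^sub>v unit_vec m i" by metis
  define X where "X = mat_of_cols n (map x [0..<m])"
  have X: "X \<in> carrier_mat n m" unfolding X_def using mat_of_cols_carrier(1)[of n "map x [0..<m]"] by simp
  have "A * X = c \<cdot>\<^sub>m 1\<^sub>m m"
  proof (rule eq_matI)
    fix i j assume "i < dim_row (c \<cdot>\<^sub>m 1\<^sub>m m)" "j < dim_col (c \<cdot>\<^sub>m 1\<^sub>m m)"
    then have ij: "i < m" "j < m" by auto
    have "col X j = x j" using ij x(1) by (simp add: X_def)
    then have "(A * X) $$ (i, j) = (A *\<^sub>v x j) $ i" using ij A X by simp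
    also have "\<dots> = (c \<cdot>\<^sub>m 1\<^sub>m m) $$ (i, j)" using ij by (simp add: x(2) unit_vec_def)
    finally show "(A * X) $$ (i, j) = (c \<cdot>\<^sub>m 1\<^sub>m m) $$ (i, j)" .
  qed (use A X in auto)
  then have "det (A * X) = c ^ m" by simp
  moreover have "d dvd det (A * X)"
    using gcd by (intro dvd_det_mult_of_dvd_maximal_minors[OF A X]) (auto simp: is_gcd_of_def)
  ultimately show ?thesis by auto
qed

lemma finite_maximal_minors: "finite (maximal_minors A)"
proof -
  have "maximal_minors A \<subseteq> (\<lambda>J. det (submatrix A UNIV J)) ` Pow {..<dim_col A}"
    by (auto simp: maximal_minors_def)
  then show ?thesis by (rule finite_subset) simp
qed

section \<open>Column spaces\<close>

lemma mult_mat_vec_smult: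
  fixes A :: "'r::comm_ring_1 mat"
  assumes "A \<in> carrier_mat m n" "v \<in> carrier_vec n"
  shows "A *\<^sub>v (r \<cdot>\<^sub>v v) = r \<cdot>\<^sub>v (A *\<^sub>v v)"
  using assms by (intro eq_vecI) (auto simp: scalar_prod_def sum_distrib_left ac_simps)

text \<open>\<open>A v\<close> is a combination of the columns of \<open>A\<close>. The closure
  properties are hypotheses on a bare set because \<open>N\<close> will be both the span of the
  differences \<open>g v - v\<close> and a column space.\<close>

lemma mult_mat_vec_mem:
  fixes A :: "'r::comm_ring_1 mat"
  assumes A: "A \<in> carrier_mat m n" and v: "v \<in> carrier_vec n"
    and zero: "0\<^sub>v m \<in> N" and add: "\<And>x y. x \<in> N \<Longrightarrow> y \<in> N \<Longrightarrow> x + y \<in> N"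
    and smult: "\<And>r x. x \<in> N \<Longrightarrow> r \<cdot>\<^sub>v x \<in> N"
    and cols: "\<And>j. j < n \<Longrightarrow> col A j \<in> N"
  shows "A *\<^sub>v v \<in> N"
proof -
  have "A *\<^sub>v v = finsum_vec TYPE('r) m (\<lambda>j. v $ j \<cdot>\<^sub>v col A j) {0..<n}"
  proof (rule eq_vecI)
    have fs: "finsum_vec TYPE('r) m (\<lambda>j. v $ j \<cdot>\<^sub>v col A j) {0..<n} \<in> carrier_vec m"
      using A by (intro finsum_vec_closed) auto
    then show "dim_vec (A *\<^sub>v v) = dim_vec (finsum_vec TYPE('r) m (\<lambda>j. v $ j \<cdot>\<^sub>v col A j) {0..<n})"
      using A by simp
    fix i assume "i < dim_vec (finsum_vec TYPE('r) m (\<lambda>j. v $ j \<cdot>\<^sub>v col A j) {0..<n})"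
    then have i: "i < m" using fs by simp
    show "(A *\<^sub>v v) $ i = finsum_vec TYPE('r) m (\<lambda>j. v $ j \<cdot>\<^sub>v col A j) {0..<n} $ i"
      using A v i by (subst index_finsum_vec) (auto simp: scalar_prod_def mult.commute intro!: sum.cong)
  qed
  also have "\<dots> \<in> N"
  proof -
    have "finsum_vec TYPE('r) m (\<lambda>j. v $ j \<cdot>\<^sub>v col A j) F \<in> N" if "finite F" "F \<subseteq> {0..<n}" for F
      using that
    proof (induction F rule: finite_induct)
      case empty
      then show ?case by (simp add: finsum_vec_empty zero)
    next
      case (insert j F)
      then show ?case using A by (subst finsum_vec_insert) (auto intro!: add smult cols)
    qed
    then show ?thesis by simp
  qed
  finally show ?thesis .
qed

lemma col_mem_range:
  fixes A :: "'r::comm_ring_1 mat"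
  assumes "A \<in> carrier_mat m n" "j < n"
  shows "col A j \<in> (\<lambda>x. A *\<^sub>v x) ` carrier_vec n"
proof
  show "col A j = A *\<^sub>v unit_vec n j"
    using assms by (intro eq_vecI) auto
qed simp

lemma range_add:
  fixes A :: "'r::comm_ring_1 mat"
  assumes "A \<in> carrier_mat m n"
    and "x \<in> (\<lambda>x. A *\<^sub>v x) ` carrier_vec n" "y \<in> (\<lambda>x. A *\<^sub>v x) ` carrier_vec n"
  shows "x + y \<in> (\<lambda>x. A *\<^sub>v x) ` carrier_vec n"
  using assms by (auto simp flip: mult_add_distrib_mat_vec)

lemma range_smult:
  fixes A :: "'r::comm_ring_1 mat"
  assumes "A \<in> carrier_mat m n" and "x \<in> (\<lambda>x. A *\<^sub>v x) ` carrier_vec n"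
  shows "r \<cdot>\<^sub>v x \<in> (\<lambda>x. A *\<^sub>v x) ` carrier_vec n"
  using assms by (auto simp flip: mult_mat_vec_smult)

section \<open>Coinvariants of a matrix representation\<close>

lemma abelian_group_module_vec: "abelian_group (module_vec TYPE('r::comm_ring_1) k)"
proof (rule abelian_groupI)
  fix x assume "x \<in> carrier (module_vec TYPE('r) k)"
  then show "\<exists>y\<in>carrier (module_vec TYPE('r) k). y \<oplus>\<^bsub>module_vec TYPE('r) k\<^esub> x = \<zero>\<^bsub>module_vec TYPE('r) k\<^esub>"
    by (intro bexI[of _ "- x"]) (auto simp: module_vec_simps)
qed (auto simp: module_vec_simps comm_add_vec)

lemma a_inv_module_vec:
  fixes v :: "'r::comm_ring_1 vec"
  assumes "v \<in> carrier_vec k"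
  shows "\<ominus>\<^bsub>module_vec TYPE('r) k\<^esub> v = - v"
  using assms by (intro abelian_group.minus_equality[OF abelian_group_module_vec]) (auto simp: module_vec_simps)

text \<open>\<open>act\<close> is kept apart from \<open>B\<close> so that it can be
  \<open>twisted_action\<close> literally, which multiplies by a matrix and then by a power of
  \<open>t\<close>; the proofs use the single matrix \<open>B g\<close>.\<close>

locale matrix_representation = group G for G :: "('g, 'a) monoid_scheme" (structure) +
  fixes k :: nat and B :: "'g \<Rightarrow> 'r::comm_ring_1 mat" and act :: "'g \<Rightarrow> 'r vec \<Rightarrow> 'r vec"
  assumes carrier_B: "g \<in> carrier G \<Longrightarrow> B g \<in> carrier_mat k k"
    and B_mult: "g \<in> carrier G \<Longrightarrow> h \<in> carrier G \<Longrightarrow> B (g \<otimes> h) = B g * B h"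
    and B_one: "B \<one> = 1\<^sub>m k"
    and act: "g \<in> carrier G \<Longrightarrow> v \<in> carrier_vec k \<Longrightarrow> act g v = B g *\<^sub>v v"
begin

abbreviation "V \<equiv> module_vec TYPE('r) k"

definition diffs :: "'r vec set" where
  "diffs = {act g v \<ominus>\<^bsub>V\<^esub> v | g v. g \<in> carrier G \<and> v \<in> carrier V}"

definition N :: "'r vec set" where
  "N = generate (add_monoid V) diffs"

lemma diffs_eq: "diffs = {B g *\<^sub>v v - v | g v. g \<in> carrier G \<and> v \<in> carrier_vec k}"
proof -
  have "act g v \<ominus>\<^bsub>V\<^esub> v = B g *\<^sub>v v - v" if "g \<in> carrier G" "v \<in> carrier_vec k" for g v
    using that carrier_B[OF that(1)]
    by (simp add: a_minus_def act a_inv_module_vec module_vec_simps minus_add_uminus_vec[of _ k])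
  then show ?thesis unfolding diffs_def module_vec_simps by (intro Collect_cong) metis
qed

lemma diffsI: "g \<in> carrier G \<Longrightarrow> v \<in> carrier_vec k \<Longrightarrow> B g *\<^sub>v v - v \<in> diffs"
  unfolding diffs_eq by blast

lemma diffs_subset: "diffs \<subseteq> carrier_vec k"
proof
  fix x assume "x \<in> diffs"
  then obtain g v where g: "g \<in> carrier G" "v \<in> carrier_vec k" and x: "x = B g *\<^sub>v v - v"
    unfolding diffs_eq by blast
  show "x \<in> carrier_vec k"
    unfolding x using mult_mat_vec_carrier[OF carrier_B[OF g(1)] g(2)] g(2) by simp
qed

sublocale V: abelian_group V by (rule abelian_group_module_vec)

lemma subgroup_N: "subgroup N (add_monoid V)"
  unfolding N_def using diffs_subset
  by (intro group.generate_is_subgroup V.a_group) (simp add: module_vec_simps)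

sublocale N: abelian_subgroup N V
  by (intro abelian_subgroupI2 V.a_comm_group subgroup_N)

lemma N_subset: "N \<subseteq> carrier_vec k"
  using subgroup.subset[OF subgroup_N] by (simp add: module_vec_simps)

lemma N_zero: "0\<^sub>v k \<in> N"
  using subgroup.one_closed[OF subgroup_N] by (simp add: module_vec_simps)

lemma N_add: "x \<in> N \<Longrightarrow> y \<in> N \<Longrightarrow> x + y \<in> N"
  using subgroup.m_closed[OF subgroup_N] by (simp add: module_vec_simps)

lemma N_diff: "g \<in> carrier G \<Longrightarrow> v \<in> carrier_vec k \<Longrightarrow> B g *\<^sub>v v - v \<in> N"
  unfolding N_def by (intro generate.incl diffsI)

text \<open>\<open>N\<close> is generated only as an additive group. It is a submodule because
  matrices commute with scalars, so the generating set is already stable under them.\<close>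

lemma N_smult:
  assumes "x \<in> N"
  shows "r \<cdot>\<^sub>v x \<in> N"
proof -
  have diff: "r \<cdot>\<^sub>v h \<in> diffs" if h_diffs: "h \<in> diffs" for h
  proof -
    obtain g v where g: "g \<in> carrier G" "v \<in> carrier_vec k" and h: "h = B g *\<^sub>v v - v"
      using h_diffs unfolding diffs_eq by blast
    have "r \<cdot>\<^sub>v h = B g *\<^sub>v (r \<cdot>\<^sub>v v) - r \<cdot>\<^sub>v v"
      using g carrier_B[OF g(1)] unfolding h
      by (subst mult_mat_vec_smult) (auto intro!: eq_vecI simp: right_diff_distrib')
    then show ?thesis using diffsI[OF g(1), of "r \<cdot>\<^sub>v v"] g(2) by simp
  qed
  show ?thesis using assms unfolding N_def
  proof (induction x rule: generate.induct)
    case one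
    have "r \<cdot>\<^sub>v 0\<^sub>v k = 0\<^sub>v k" by (intro eq_vecI) auto
    then show ?case using N_zero by (simp add: module_vec_simps N_def)
  next
    case (incl h)
    then show ?case using diff by (auto intro: generate.incl)
  next
    case (inv h)
    have h: "h \<in> carrier_vec k" using inv diffs_subset by auto
    have inv_eq: "inv\<^bsub>add_monoid V\<^esub> w = - w" if "w \<in> carrier_vec k" for w
      using a_inv_module_vec[OF that] by (simp add: a_inv_def)
    have "r \<cdot>\<^sub>v (inv\<^bsub>add_monoid V\<^esub> h) = inv\<^bsub>add_monoid V\<^esub> (r \<cdot>\<^sub>v h)"
      using h by (auto simp: inv_eq intro!: eq_vecI)
    then show ?case using diff[OF inv] by (auto intro: generate.inv)
  next
    case (eng x y)
    have "x \<in> carrier_vec k" "y \<in> carrier_vec k" using eng(1,2) N_subset by (auto simp: N_def)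
    then have "r \<cdot>\<^sub>v (x \<otimes>\<^bsub>add_monoid V\<^esub> y) = (r \<cdot>\<^sub>v x) \<otimes>\<^bsub>add_monoid V\<^esub> (r \<cdot>\<^sub>v y)"
      by (simp add: module_vec_simps smult_add_distrib_vec[of _ k])
    then show ?case using generate.eng[OF eng(3,4)] by simp
  qed
qed

lemma homology_eq: "group_homology0 G V act = quot_module V N"
  unfolding group_homology0_def N_def diffs_def ..

lemma r_coset_eq: "N +>\<^bsub>V\<^esub> v = (\<lambda>h. h + v) ` N"
  by (auto simp: a_r_coset_def r_coset_def module_vec_simps)

lemma r_coset_cong:
  assumes "h \<in> N" "v \<in> carrier_vec k"
  shows "N +>\<^bsub>V\<^esub> (h + v) = N +>\<^bsub>V\<^esub> v"
proof -
  have "N +>\<^bsub>V\<^esub> (h + v) = N +>\<^bsub>V\<^esub> h +>\<^bsub>V\<^esub> v"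
    using assms N_subset V.a_coset_add_assoc[of N h v] by (auto simp: module_vec_simps)
  then show ?thesis using N.a_rcos_const[OF assms(1)] by simp
qed

lemma quot_smult:
  assumes v: "v \<in> carrier_vec k"
  shows "r \<odot>\<^bsub>quot_module V N\<^esub> (N +>\<^bsub>V\<^esub> v) = N +>\<^bsub>V\<^esub> (r \<cdot>\<^sub>v v)"
proof -
  have "N +>\<^bsub>V\<^esub> (r \<cdot>\<^sub>v x) = N +>\<^bsub>V\<^esub> (r \<cdot>\<^sub>v v)" if x: "x \<in> N +>\<^bsub>V\<^esub> v" for x
  proof -
    obtain h where h: "h \<in> N" "x = h + v" using x by (auto simp: r_coset_eq)
    then have "r \<cdot>\<^sub>v x = r \<cdot>\<^sub>v h + r \<cdot>\<^sub>v v"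
      using v N_subset by (auto simp: smult_add_distrib_vec[of _ k])
    then show ?thesis using r_coset_cong N_smult[OF h(1)] v by simp
  qed
  \<comment> \<open>Scalar multiplication of a coset is a union over its representatives. All of
    them give the same coset, and since there is at least one, the union equals it.\<close>
  moreover have "N +>\<^bsub>V\<^esub> v \<noteq> {}" using N_zero by (auto simp: r_coset_eq)
  ultimately show ?thesis by (auto simp: quot_module_def module_vec_simps)
qed

lemma quot_carrier: "carrier (quot_module V N) = (\<lambda>v. N +>\<^bsub>V\<^esub> v) ` carrier_vec k"
  by (auto simp: quot_module_def A_RCOSETS_def RCOSETS_def a_r_coset_def module_vec_simps)

lemma quot_annihilated:
  assumes ann: "\<And>v. v \<in> carrier_vec k \<Longrightarrow> c \<cdot>\<^sub>v v \<in> N" and x: "x \<in> carrier (quot_module V N)"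
  shows "c \<odot>\<^bsub>quot_module V N\<^esub> x = \<zero>\<^bsub>quot_module V N\<^esub>"
proof -
  obtain v where v: "v \<in> carrier_vec k" "x = N +>\<^bsub>V\<^esub> v" using x by (auto simp: quot_carrier)
  then show ?thesis
    using N.a_rcos_const[OF ann[OF v(1)]] by (simp add: quot_smult) (simp add: quot_module_def)
qed

lemma presentation_of_range:
  assumes A: "A \<in> carrier_mat k n" and N: "N = (\<lambda>x. A *\<^sub>v x) ` carrier_vec n"
  shows "is_presentation_matrix (quot_module V N) A"
proof -
  let ?f = "\<lambda>v. N +>\<^bsub>V\<^esub> v"
  have "?f \<in> epi (add_monoid V) (add_monoid (quot_module V N))"
  proof -
    have "?f (x + y) = ?f x <+>\<^bsub>V\<^esub> ?f y" if "x \<in> carrier_vec k" "y \<in> carrier_vec k" for x y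
      using N.a_rcos_sum[of x y] that by (simp add: module_vec_simps)
    then show ?thesis
      unfolding epi_def hom_def by (auto simp: quot_carrier module_vec_simps) (auto simp: quot_module_def)
  qed
  moreover have "a_kernel V (quot_module V N) ?f = N"
  proof -
    have "?f v = N \<longleftrightarrow> v \<in> N" if "v \<in> carrier_vec k" for v
      using V.a_coset_join1[OF _ _ subgroup_N, of v] N.a_rcos_const[of v] that by (auto simp: module_vec_simps)
    then show ?thesis
      using N_subset by (auto simp: a_kernel_def kernel_def module_vec_simps quot_module_def)
  qed
  ultimately show ?thesis
    unfolding is_presentation_matrix_def using A N quot_smult by (intro bexI[of _ ?f]) auto
qed

text \<open>The columns of \<open>B s - 1\<close> for \<open>s\<close> in a finite generating set
  suffice, by \<open>g h - 1 = (g - 1) h + (h - 1)\<close> and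
  \<open>s^-1 - 1 = - (s - 1) s^-1\<close>. This yields a finite presentation of the coinvariants
  with \<open>k\<close> generators.\<close>

lemma N_eq_range:
  assumes S: "finite S" "S \<subseteq> carrier G" "generate G S = carrier G"
  shows "\<exists>n A. A \<in> carrier_mat k n \<and> N = (\<lambda>x. A *\<^sub>v x) ` carrier_vec n"
proof -
  obtain ss where ss: "set ss = S" using finite_list[OF S(1)] by blast
  define vs where "vs = concat (map (\<lambda>s. map (\<lambda>j. col (B s - 1\<^sub>m k) j) [0..<k]) ss)"
  define A where "A = mat_of_cols k vs"
  define n where "n = length vs"
  have vs: "set vs = {col (B s - 1\<^sub>m k) j | s j. s \<in> S \<and> j < k}"
    by (auto simp: vs_def ss) blast
  have A: "A \<in> carrier_mat k n" by (simp add: A_def n_def)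
  have vs_carrier: "w \<in> carrier_vec k" if "w \<in> set vs" for w
    using that by (auto simp: vs intro!: carrier_vecI)
  have col_A: "col A j = vs ! j" if "j < n" for j
    using that vs_carrier[of "vs ! j"] by (simp add: A_def n_def)
  define I where "I = (\<lambda>x. A *\<^sub>v x) ` carrier_vec n"
  have I_zero: "0\<^sub>v k \<in> I"
    unfolding I_def using A by (intro image_eqI[of _ _ "0\<^sub>v n"]) auto
  note I_add = range_add[OF A, folded I_def] and I_smult = range_smult[OF A, folded I_def]
  have I_carrier: "I \<subseteq> carrier_vec k" using A by (auto simp: I_def)
  have I_col: "w \<in> I" if w: "w \<in> set vs" for w
  proof -
    obtain j where "j < n" "w = vs ! j" using w unfolding in_set_conv_nth n_def by metis
    then show ?thesis using col_mem_range[OF A, of j] col_A by (simp add: I_def)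
  qed
  have Bm: "(B g - 1\<^sub>m k) *\<^sub>v v = B g *\<^sub>v v - v" if "g \<in> carrier G" "v \<in> carrier_vec k" for g v
    using that carrier_B[OF that(1)] by (simp add: minus_mult_distrib_mat_vec[of _ k k])
  have gen_I: "(B s - 1\<^sub>m k) *\<^sub>v v \<in> I" if s: "s \<in> S" and v: "v \<in> carrier_vec k" for s v
  proof -
    have "B s - 1\<^sub>m k \<in> carrier_mat k k" by (intro carrier_matI) auto
    moreover have "col (B s - 1\<^sub>m k) j \<in> I" if "j < k" for j
      using s that by (intro I_col) (auto simp: vs)
    ultimately show ?thesis using mult_mat_vec_mem[OF _ v I_zero I_add I_smult] by blast
  qed
  have "I \<subseteq> N"
  proof
    fix x assume "x \<in> I"
    then obtain v where v: "v \<in> carrier_vec n" "x = A *\<^sub>v v" by (auto simp: I_def)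
    have "col A j \<in> N" if "j < n" for j
    proof -
      have "vs ! j \<in> set vs" using that by (simp add: n_def)
      then obtain s i where s: "s \<in> S" "i < k" "vs ! j = col (B s - 1\<^sub>m k) i" by (auto simp: vs)
      have sG: "s \<in> carrier G" using s S by auto
      have "col (B s - 1\<^sub>m k) i = (B s - 1\<^sub>m k) *\<^sub>v unit_vec k i"
        using s carrier_B[OF sG] by (intro eq_vecI) auto
      then show ?thesis using Bm[OF sG] N_diff[OF sG] s col_A[OF that] by simp
    qed
    then show "x \<in> N" unfolding v(2) using mult_mat_vec_mem[OF A v(1) N_zero N_add N_smult] by blast
  qed
  \<comment> \<open>The vector varies in the induction: for a product, the hypothesis on
    \<open>g\<close> is applied to \<open>B h *\<^sub>v v\<close>.\<close>
  moreover have diff_I: "B g *\<^sub>v v - v \<in> I" if "g \<in> generate G S" "v \<in> carrier_vec k" for g v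
    using that
  proof (induction g arbitrary: v rule: generate.induct)
    case one
    then show ?case using I_zero by (simp add: B_one)
  next
    case (incl s)
    have sG: "s \<in> carrier G" using incl S by auto
    show ?case using gen_I[OF incl] Bm[OF sG incl(2)] by simp
  next
    case (inv s)
    have sG: "s \<in> carrier G" using inv S by auto
    note BB = carrier_B[OF sG] carrier_B[OF inv_closed[OF sG]]
    define w where "w = B (inv s) *\<^sub>v v"
    have w: "w \<in> carrier_vec k" using BB inv by (simp add: w_def)
    have "B s *\<^sub>v w = (B s * B (inv s)) *\<^sub>v v"
      using BB inv by (simp add: w_def)
    also have "B s * B (inv s) = 1\<^sub>m k" using B_mult[OF sG inv_closed[OF sG]] sG B_one by simp
    finally have Bw: "B s *\<^sub>v w = v" using inv by simp
    have "v - w \<in> I" using gen_I[OF inv(1) w] Bm[OF sG w] Bw by simp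
    then have "- 1 \<cdot>\<^sub>v (v - w) \<in> I" by (rule I_smult)
    also have "- 1 \<cdot>\<^sub>v (v - w) = w - v" using w inv by (intro eq_vecI) auto
    finally show ?case by (simp add: w_def)
  next
    case (eng g h)
    have gh: "g \<in> carrier G" "h \<in> carrier G" using eng(1,2) S by auto
    note BB = carrier_B[OF gh(1)] carrier_B[OF gh(2)]
    have hv: "B h *\<^sub>v v \<in> carrier_vec k" using BB eng.prems by simp
    have "B (g \<otimes> h) *\<^sub>v v = B g *\<^sub>v (B h *\<^sub>v v)"
      using BB eng.prems by (simp add: B_mult gh)
    then have "B (g \<otimes> h) *\<^sub>v v - v = (B g *\<^sub>v (B h *\<^sub>v v) - B h *\<^sub>v v) + (B h *\<^sub>v v - v)"
      using BB hv eng.prems by (intro eq_vecI) auto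
    then show ?case using I_add eng.IH(1)[OF hv] eng.IH(2)[OF eng.prems] by simp
  qed
  moreover have "N \<subseteq> I"
  proof -
    have "subgroup I (add_monoid V)"
    proof (rule group.subgroupI[OF V.a_group])
      fix a assume a: "a \<in> I"
      then have ac: "a \<in> carrier_vec k" using I_carrier by auto
      have "- 1 \<cdot>\<^sub>v a \<in> I" using a by (rule I_smult)
      also have "- 1 \<cdot>\<^sub>v a = - a" using ac by (intro eq_vecI) auto
      finally show "inv\<^bsub>add_monoid V\<^esub> a \<in> I" using a_inv_module_vec[OF ac] by (simp add: a_inv_def)
    qed (use I_carrier I_zero I_add in \<open>auto simp: module_vec_simps\<close>)
    moreover have "diffs \<subseteq> I" using diff_I S(3) unfolding diffs_eq by blast
    ultimately show ?thesis unfolding N_def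
      by (intro group.generate_subgroup_incl[OF V.a_group])
  qed
  ultimately show ?thesis using A unfolding I_def by blast
qed

lemma homology_presentation_exists:
  assumes "finitely_generated_group G"
  shows "\<exists>A. is_presentation_matrix (group_homology0 G V act) A"
  using assms N_eq_range presentation_of_range unfolding homology_eq finitely_generated_group_def by metis

text \<open>When \<open>g\<close> acts as the scalar \<open>c\<close>, the differences
  \<open>g v - v\<close> are the multiples \<open>(c - 1) v\<close>, so \<open>c - 1\<close>
  annihilates the coinvariants.\<close>

lemma homology_order_dvd:
  assumes ord: "is_order_of (group_homology0 G V act) d" and g: "g \<in> carrier G"
    and Bg: "B g = c \<cdot>\<^sub>m 1\<^sub>m k"
  shows "\<exists>m. d dvd (c - 1) ^ m"
proof (rule order_dvd_annihilator_power[OF ord])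
  fix x assume x: "x \<in> carrier (group_homology0 G V act)"
  have "(c - 1) \<cdot>\<^sub>v v \<in> N" if v: "v \<in> carrier_vec k" for v
  proof -
    have "B g *\<^sub>v v - v = (c - 1) \<cdot>\<^sub>v v"
      unfolding Bg using v by (intro eq_vecI) (auto simp: algebra_simps)
    then show ?thesis using N_diff[OF g v] by simp
  qed
  then show "(c - 1) \<odot>\<^bsub>group_homology0 G V act\<^esub> x = \<zero>\<^bsub>group_homology0 G V act\<^esub>"
    using quot_annihilated x unfolding homology_eq by blast
qed

end

section \<open>The twisted Alexander polynomial\<close>

lemma lconst_hom: "comm_ring_hom lconst"
  by unfold_locales (simp_all add: single_add mult_single)

lemma general_linear_group_simps:
  "A \<in> carrier (general_linear_group k) \<Longrightarrow> A \<in> carrier_mat k k"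
  "A \<otimes>\<^bsub>general_linear_group k\<^esub> A' = A * A'"
  "\<one>\<^bsub>general_linear_group k\<^esub> = 1\<^sub>m k"
  by (auto simp: general_linear_group_def units_of_def ring_mat_def Units_def)

lemma group_general_linear_group: "group (general_linear_group k)"
  unfolding general_linear_group_def
  by (intro monoid.units_group ring.is_monoid) (simp add: ring_mat)

definition twisted_matrix :: "('g \<Rightarrow> int) \<Rightarrow> ('g \<Rightarrow> rat mat) \<Rightarrow> 'g \<Rightarrow> laurent mat" where
  "twisted_matrix \<phi> \<rho> g = tpow (\<phi> g) \<cdot>\<^sub>m map_mat lconst (\<rho> g)"

lemma matrix_representation_twisted:
  assumes G: "group G" and \<phi>: "\<phi> \<in> hom G integer_group"
    and \<rho>: "\<rho> \<in> hom G (general_linear_group k)"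
  shows "matrix_representation G k (twisted_matrix \<phi> \<rho>) (twisted_action \<phi> \<rho>)"
proof -
  interpret G: group G by (rule G)
  interpret lconst: comm_ring_hom lconst by (rule lconst_hom)
  have \<rho>_carrier: "\<rho> g \<in> carrier_mat k k" if "g \<in> carrier G" for g
    using \<rho> that by (auto simp: hom_def intro: general_linear_group_simps)
  have \<rho>_mult: "\<rho> (g \<otimes>\<^bsub>G\<^esub> h) = \<rho> g * \<rho> h" if "g \<in> carrier G" "h \<in> carrier G" for g h
    using \<rho> that by (simp add: hom_def general_linear_group_simps)
  have \<rho>_one: "\<rho> \<one>\<^bsub>G\<^esub> = 1\<^sub>m k"
    using hom_one[OF \<rho> G group_general_linear_group] by (simp add: general_linear_group_simps)
  have \<phi>_mult: "\<phi> (g \<otimes>\<^bsub>G\<^esub> h) = \<phi> g + \<phi> h" if "g \<in> carrier G" "h \<in> carrier G" for g h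
    using \<phi> that by (simp add: hom_def)
  have \<phi>_one: "\<phi> \<one>\<^bsub>G\<^esub> = 0"
    using hom_one[OF \<phi> G group_integer_group] by simp
  show ?thesis
  proof
    fix g assume g: "g \<in> carrier G"
    show "twisted_matrix \<phi> \<rho> g \<in> carrier_mat k k"
      using \<rho>_carrier[OF g] by (simp add: twisted_matrix_def)
  next
    fix g h assume g: "g \<in> carrier G" "h \<in> carrier G"
    have "twisted_matrix \<phi> \<rho> (g \<otimes>\<^bsub>G\<^esub> h)
        = (tpow (\<phi> g) * tpow (\<phi> h)) \<cdot>\<^sub>m (map_mat lconst (\<rho> g) * map_mat lconst (\<rho> h))"
      using lconst.mat_hom_mult[OF \<rho>_carrier[OF g(1)] \<rho>_carrier[OF g(2)]]
      by (simp add: twisted_matrix_def \<phi>_mult[OF g] \<rho>_mult[OF g] mult_single)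
    also have "\<dots> = twisted_matrix \<phi> \<rho> g * twisted_matrix \<phi> \<rho> h"
      using \<rho>_carrier[OF g(1)] \<rho>_carrier[OF g(2)]
      by (intro eq_matI) (auto simp: twisted_matrix_def scalar_prod_def sum_distrib_left ac_simps)
    finally show "twisted_matrix \<phi> \<rho> (g \<otimes>\<^bsub>G\<^esub> h) = twisted_matrix \<phi> \<rho> g * twisted_matrix \<phi> \<rho> h" .
  next
    show "twisted_matrix \<phi> \<rho> \<one>\<^bsub>G\<^esub> = 1\<^sub>m k"
      by (intro eq_matI) (auto simp: twisted_matrix_def \<phi>_one \<rho>_one lconst.mat_hom_one)
  next
    fix g and v :: "laurent vec" assume g: "g \<in> carrier G" and v: "v \<in> carrier_vec k"
    show "twisted_action \<phi> \<rho> g v = twisted_matrix \<phi> \<rho> g *\<^sub>v v"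
      using \<rho>_carrier[OF g] v
      by (intro eq_vecI)
        (auto simp: twisted_action_def twisted_matrix_def scalar_prod_def sum_distrib_left ac_simps)
  qed
qed

theorem lemma3p5:
  fixes G :: "('g, 'a) monoid_scheme"
    and Q :: "('q, 'b) monoid_scheme"
    and k :: nat
    and \<phi> :: "'g \<Rightarrow> int"
    and \<rho> :: "'g \<Rightarrow> rat mat"
    and \<pi> :: "'g \<Rightarrow> 'q"
    and \<sigma> :: "'q \<Rightarrow> rat mat"
  assumes "finitely_generated_group G"
    and "algebraically_fibred G \<phi>"
    and "group Q" and "finite (carrier Q)"
    and "\<pi> \<in> epi G Q"
    and "\<sigma> \<in> hom Q (general_linear_group k)"
    and "\<And>g. g \<in> carrier G \<Longrightarrow> \<rho> g = \<sigma> (\<pi> g)"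
  shows "(\<exists>\<Delta>. is_twisted_alexander0 G k \<phi> \<rho> \<Delta>) \<and>
    (\<forall>\<Delta>. is_twisted_alexander0 G k \<phi> \<rho> \<Delta> \<longrightarrow>
       (\<exists>(m::nat) P. is_product_of_cyclotomics P \<and> \<Delta> \<doteq> (1 - tpow 1) ^ m * P) \<and>
       \<Delta> \<doteq> subst_inverse \<Delta>)"
proof -
  interpret G: group G using assms(1) by (simp add: finitely_generated_group_def)
  interpret Q: group Q by (rule assms(3))
  interpret lconst: comm_ring_hom lconst by (rule lconst_hom)
  have \<pi>: "\<pi> \<in> hom G Q" using assms(5) by (simp add: epi_def)
  have \<phi>: "\<phi> \<in> hom G integer_group" and \<phi>_surj: "\<phi> ` carrier G = UNIV"
    using assms(2) by (auto simp: algebraically_fibred_def epi_def)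
  have \<rho>: "\<rho> \<in> hom G (general_linear_group k)"
    using hom_compose[OF \<pi> assms(6)] assms(7) by (auto simp: hom_def)
  interpret matrix_representation G k "twisted_matrix \<phi> \<rho>" "twisted_action \<phi> \<rho>"
    by (rule matrix_representation_twisted[OF G.group_axioms \<phi> \<rho>])
  \<comment> \<open>Finiteness of \<open>Q\<close> makes \<open>q\<close> positive; for an infinite
    group \<open>order\<close> is 0, and \<open>t ^ q - 1\<close> would be zero.\<close>
  define q where "q = Coset.order Q"
  have q: "q > 0" using assms(4) by (simp add: q_def Q.order_gt_0_iff_finite)
  obtain g where g: "g \<in> carrier G" "\<phi> g = 1" using \<phi>_surj by (metis UNIV_I imageE)
  have gq: "g [^]\<^bsub>G\<^esub> q \<in> carrier G" using g by simp
  have "\<pi> (g [^]\<^bsub>G\<^esub> q) = \<one>\<^bsub>Q\<^esub>"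
  proof -
    have "\<pi> (g [^]\<^bsub>G\<^esub> q) = \<pi> g [^]\<^bsub>Q\<^esub> q"
      using group_hom.hom_nat_pow[of G Q \<pi> g q] \<pi> g(1)
      by (simp add: group_hom_def group_hom_axioms_def G.group_axioms Q.group_axioms)
    also have "\<dots> = \<one>\<^bsub>Q\<^esub>"
      unfolding q_def using \<pi> g(1) by (intro Q.pow_order_eq_1) (auto simp: hom_def)
    finally show ?thesis .
  qed
  then have "\<rho> (g [^]\<^bsub>G\<^esub> q) = 1\<^sub>m k"
    using assms(7)[OF gq] hom_one[OF assms(6) Q.group_axioms group_general_linear_group]
    by (simp add: general_linear_group_simps)
  moreover have "\<phi> (g [^]\<^bsub>G\<^esub> q) = int q"
  proof -
    have "\<phi> (g [^]\<^bsub>G\<^esub> n) = int n" for n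
    proof (induction n)
      case 0
      show ?case using hom_one[OF \<phi> G.group_axioms group_integer_group] by simp
    next
      case (Suc n)
      then show ?case using \<phi> g by (simp add: hom_def)
    qed
    then show ?thesis .
  qed
  ultimately have Bg: "twisted_matrix \<phi> \<rho> (g [^]\<^bsub>G\<^esub> q) = tpow (int q) \<cdot>\<^sub>m 1\<^sub>m k"
    by (simp add: twisted_matrix_def lconst.mat_hom_one)
  \<comment> \<open>Finite generation of \<open>G\<close> gives a presentation matrix, and its
    finitely many maximal minors have a greatest common divisor.\<close>
  have "\<exists>\<Delta>. is_twisted_alexander0 G k \<phi> \<rho> \<Delta>"
    unfolding is_twisted_alexander0_def is_order_of_def
    using homology_presentation_exists[OF assms(1)] is_gcd_of_exists[OF finite_maximal_minors] by blast
  moreover have "(\<exists>m P. is_product_of_cyclotomics P \<and> \<Delta> \<doteq> (1 - tpow 1) ^ m * P) \<and>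
      \<Delta> \<doteq> subst_inverse \<Delta>" if "is_twisted_alexander0 G k \<phi> \<rho> \<Delta>" for \<Delta>
    using homology_order_dvd[OF that[unfolded is_twisted_alexander0_def] gq Bg]
      cyclotomic_and_reciprocal_of_dvd[OF _ q] by blast
  ultimately show ?thesis by blast
qed

end
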